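(* For every $d\ge1$, the set $\operatorname{trop}(\mathcal{B}\Sigma_{2d}^* )$ is a rational polyhedron.
   Context: Let $\Lambda_{2d}^{\varepsilon}$ be the set of partitions of $2d$ all of whose parts are even. For a partition $\lambda$, $p_\lambda=\prod_i p_{\lambda_i}$ with $p_r=X_1^r+\cdots+X_n^r$. $\mathcal{B}\Sigma_{2d}$ is the set of $c\in\mathbb{R}^{\Lambda_{2d}^\varepsilon}$ such that for every $n\ge2d$ the form $\sum_\lambda c_\lambda p_\lambda(X_1,\dots,X_n)$ is a sum of squares of real polynomials. Its dual cone is $\mathcal{B}\Sigma_{2d}^*=\{\varphi\in\mathbb{R}^{\Lambda_{2d}^\varepsilon}:\sum_\lambda c_\lambda\varphi_\lambda\ge0\ \text{for all } c\in\mathcal{B}\Sigma_{2d}\}$, which lies in the nonnegative orthant. For $S\subset\mathbb{R}_{\ge0}^s$, $\operatorname{trop}(S)=\lim_{t\to\infty}\log_t(S\cap\mathbb{R}_{>0}^s)$ with $\log_t$ applied coordinatewise; equivalently $y\in\operatorname{trop}(S)$ iff there are sequences $x^{(m)}\in S\cap\mathbb{R}_{>0}^s$ and $\tau_m\in(0,1)$ with $\tau_m\to0$ and $y=\lim_{m\to\infty}\log_{1/\tau_m}(x^{(m)})$. A rational polyhedron is a solution set of finitely many linear inequalities with rational coefficients. *)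

theory Defs
  imports
    Complex_Main
    "HOL-Library.FuncSet"
    "HOL-Library.Multiset"
    "HOL-Library.Poly_Mapping"
begin

text \<open>
  Real polynomials in variables \<open>X\<^sub>0, X\<^sub>1, \<dots>\<close>, as finitely supported coefficient functions on
  finitely supported exponent vectors; \<open>\<real>[X\<^sub>0, \<dots>, X\<^sub>n\<^sub>-\<^sub>1]\<close> is the subring \<open>polys_in n\<close>.
\<close>

type_synonym rpoly = "(nat \<Rightarrow>\<^sub>0 nat) \<Rightarrow>\<^sub>0 real"

definition Const :: "real \<Rightarrow> rpoly" where
  "Const a = Poly_Mapping.single 0 a"

definition Var :: "nat \<Rightarrow> rpoly" where
  "Var i = Poly_Mapping.single (Poly_Mapping.single i 1) 1"

definition polys_in :: "nat \<Rightarrow> rpoly set" where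
  "polys_in n = {p. \<forall>m \<in> Poly_Mapping.keys p. Poly_Mapping.keys m \<subseteq> {..<n}}"

definition sum_of_squares :: "nat \<Rightarrow> rpoly \<Rightarrow> bool" where
  "sum_of_squares n f \<longleftrightarrow> (\<exists>qs. set qs \<subseteq> polys_in n \<and> f = (\<Sum>q\<leftarrow>qs. q ^ 2))"

text \<open>A partition is the multiset of its (positive) parts.\<close>

definition even_partitions :: "nat \<Rightarrow> nat multiset set" where
  "even_partitions k = {l. sum_mset l = k \<and> (\<forall>r \<in># l. 0 < r \<and> even r)}"

lemma finite_even_partitions: "finite (even_partitions k)"
proof -
  have size_le: "size l \<le> sum_mset l" if "\<forall>r \<in># l. 0 < r" for l :: "nat multiset"
    using that by (induction l) auto
  have "even_partitions k \<subseteq> mset ` {xs. set xs \<subseteq> {..k} \<and> length xs \<le> k}"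
  proof
    fix l assume l: "l \<in> even_partitions k"
    obtain xs where xs: "l = mset xs" by (metis ex_mset)
    have "length xs \<le> k"
      using size_le[of l] l xs by (auto simp: even_partitions_def)
    moreover have "set xs \<subseteq> {..k}"
      using l xs member_le_sum_list by (fastforce simp: even_partitions_def sum_mset_sum_list)
    ultimately show "l \<in> mset ` {xs. set xs \<subseteq> {..k} \<and> length xs \<le> k}"
      using xs by blast
  qed
  then show ?thesis
    by (rule finite_subset) (simp add: finite_lists_length_le)
qed

definition power_sum :: "nat \<Rightarrow> nat \<Rightarrow> rpoly" where
  "power_sum n r = (\<Sum>i<n. Var i ^ r)"

definition power_sum_product :: "nat \<Rightarrow> nat multiset \<Rightarrow> rpoly" where
  "power_sum_product n l = (\<Prod>r\<in>#l. power_sum n r)"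

text \<open>
  For a finite index set \<open>I\<close>, the space \<open>\<real>\<^sup>I\<close> is represented by the extensional functions
  \<open>I \<rightarrow>\<^sub>E UNIV\<close>; values outside \<open>I\<close> carry no information.
\<close>

definition BSigma :: "nat \<Rightarrow> (nat multiset \<Rightarrow> real) set" where
  "BSigma k = {c \<in> even_partitions k \<rightarrow>\<^sub>E UNIV.
     \<forall>n\<ge>k. sum_of_squares n (\<Sum>l\<in>even_partitions k. Const (c l) * power_sum_product n l)}"

definition dual_cone :: "'i set \<Rightarrow> ('i \<Rightarrow> real) set \<Rightarrow> ('i \<Rightarrow> real) set" where
  "dual_cone I C = {\<phi> \<in> I \<rightarrow>\<^sub>E UNIV. \<forall>c\<in>C. 0 \<le> (\<Sum>i\<in>I. c i * \<phi> i)}"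

text \<open>
  The tropicalization \<open>lim\<^bsub>t\<rightarrow>\<infinity>\<^esub> log\<^sub>t (S \<inter> \<real>\<^bsub>>0\<^esub>\<^sup>I)\<close>, described by sequences, with base \<open>t = 1 / \<tau>\<close>.
\<close>

definition trop :: "'i set \<Rightarrow> ('i \<Rightarrow> real) set \<Rightarrow> ('i \<Rightarrow> real) set" where
  "trop I S = {y \<in> I \<rightarrow>\<^sub>E UNIV. \<exists>x :: nat \<Rightarrow> 'i \<Rightarrow> real. \<exists>\<tau> :: nat \<Rightarrow> real.
     (\<forall>m. x m \<in> S \<and> (\<forall>i\<in>I. 0 < x m i)) \<and>
     (\<forall>m. 0 < \<tau> m \<and> \<tau> m < 1) \<and> \<tau> \<longlonglongrightarrow> 0 \<and>
     (\<forall>i\<in>I. (\<lambda>m. log (1 / \<tau> m) (x m i)) \<longlonglongrightarrow> y i)}"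

definition rational_polyhedron :: "'i set \<Rightarrow> ('i \<Rightarrow> real) set \<Rightarrow> bool" where
  "rational_polyhedron I P \<longleftrightarrow>
     (\<exists>H :: (('i \<Rightarrow> rat) \<times> rat) set. finite H \<and>
        P = {y \<in> I \<rightarrow>\<^sub>E UNIV. \<forall>(a, b) \<in> H. (\<Sum>i\<in>I. of_rat (a i) * y i) \<le> of_rat b})"

end

(* Expanding products of power sums shows that p_a p_b p_mu - p_(a+b) p_mu and
   prod p_(2a) f^2 - 2 prod p_(a+b) f g + prod p_(2b) g^2, over a finite family of pairs (a, b),
   are sums of squares for every n. On the dual cone they give x_l' <= x_l and
   x_l'^2 <= x_l1 x_l3, so every y in the tropicalization satisfies finitely many inequalities
   2 y_l' <= y_l1 + y_l3.

   Conversely let y satisfy them, and perturb y so that the second family is strict. For the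
   rescaled point z = y / N with N large, let phi_n be the symmetric functional sending a monomial
   with even exponents and shape mu to n^(z_mu - #mu). Then phi_n(p_l) has order n^(z_l), so
   log in base n^(1/N) of these values tends to y. It remains to see that phi_n is nonnegative on
   squares of forms of degree d for large n. An eigenvector for a negative eigenvalue of its Gram
   matrix can be averaged over the permutations fixing the support of one monomial; on vectors
   invariant under such permutations the Gram matrix has a size independent of n, and the strict
   inequalities make it diagonally dominant as n grows. *)

theory Submission
  imports Defs "HOL-Analysis.Analysis" "HOL-Combinatorics.Permutations"
begin

section \<open>Nonnegative quadratic forms\<close>

text \<open>A form given by \<open>BSigma\<close> is a sum of squares in every number
  \<open>n\<close> \<ge> \<open>2 * d\<close> of variables, so each single \<open>n\<close> yields a
  candidate dual point and \<open>n\<close> is free to grow. The obstacle is that the Gram matrix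
  grows with it, and that averaging a vector over all permutations may give zero. Fixing the support
  \<open>W\<close> of one monomial avoids the cancellation and excludes at most \<open>d\<close>
  variables from the averaging; up to symmetry, a monomial is then known by its exponents on
  \<open>W\<close> and its shape elsewhere.

  The block sum of two such classes is bounded by a power of \<open>n\<close>, which is attained up
  to a constant on the diagonal: outside \<open>W\<close> the number of positions cancels the factor
  1/n of each variable, inside \<open>W\<close> that factor remains. Dominance thus compares
  exponents. Classes with different supports in \<open>W\<close> are separated by counting
  variables, provided that the values of \<open>z\<close> are small; this is why \<open>y\<close> is
  divided by \<open>N\<close>, which only changes the base of the logarithm. Classes with the same
  support are separated by the second family of inequalities. A tie would leave constant factors to
  compare, hence the perturbation.\<close>

lemma linear_coeff_zero:
  fixes a b :: real
  assumes "\<And>t. 0 \<le> 2 * t * a + t\<^sup>2 * b"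
  shows "a = 0"
proof (rule ccontr)
  assume "a \<noteq> 0"
  \<comment> \<open>A positive bound in place of \<open>b\<close>, which may be zero or negative;
    the resulting quadratic in \<open>t\<close> has its minimum at \<open>- a / c\<close>.\<close>
  define c where "c = \<bar>b\<bar> + 1"
  have c: "c > 0" "b \<le> c" by (auto simp: c_def)
  have "0 \<le> 2 * (- a / c) * a + (- a / c)\<^sup>2 * b" by (rule assms)
  also have "\<dots> \<le> 2 * (- a / c) * a + (- a / c)\<^sup>2 * c"
    using c by (intro add_left_mono mult_left_mono) auto
  also have "\<dots> = - a\<^sup>2 / c" using c by (simp add: field_simps power2_eq_square)
  also have "\<dots> < 0" using c \<open>a \<noteq> 0\<close> by simp
  finally show False by simp
qed

lemma quadratic_form_add_single:
  fixes M :: "'a \<Rightarrow> 'a \<Rightarrow> real"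
  assumes F: "finite F" and sym: "\<And>a b. a \<in> F \<Longrightarrow> b \<in> F \<Longrightarrow> M a b = M b a" and c: "c \<in> F"
  shows "(\<Sum>a\<in>F. \<Sum>b\<in>F. (w a + (if a = c then t else 0)) * (w b + (if b = c then t else 0)) * M a b) =
    (\<Sum>a\<in>F. \<Sum>b\<in>F. w a * w b * M a b) + 2 * t * (\<Sum>b\<in>F. M c b * w b) + t\<^sup>2 * M c c"
proof -
  have "(\<Sum>a\<in>F. \<Sum>b\<in>F. (w a + (if a = c then t else 0)) * (w b + (if b = c then t else 0)) * M a b) =
     (\<Sum>a\<in>F. \<Sum>b\<in>F. w a * w b * M a b) + (\<Sum>a\<in>F. \<Sum>b\<in>F. if b = c then w a * t * M a b else 0)
     + (\<Sum>a\<in>F. if a = c then (\<Sum>b\<in>F. t * w b * M a b) else 0)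
     + (\<Sum>a\<in>F. if a = c then (\<Sum>b\<in>F. if b = c then t * t * M a b else 0) else 0)"
    unfolding sum.distrib[symmetric]
    by (intro sum.cong refl) (auto simp: sum.distrib[symmetric] algebra_simps intro!: sum.cong)
  also have "(\<Sum>a\<in>F. \<Sum>b\<in>F. if b = c then w a * t * M a b else 0) = t * (\<Sum>a\<in>F. M c a * w a)"
    using F c by (simp add: sum_distrib_left sym[OF _ c] mult_ac cong: sum.cong)
  finally show ?thesis
    using F c by (simp add: sum_distrib_left power2_eq_square mult_ac)
qed

text \<open>The quadratic form attains its minimum on the unit sphere by compactness. The minimum is
  negative, and stationarity in each coordinate direction is the eigenvector equation.\<close>

lemma negative_eigenvector:
  fixes M :: "'a \<Rightarrow> 'a \<Rightarrow> real"
  assumes F: "finite F" and sym: "\<And>a b. a \<in> F \<Longrightarrow> b \<in> F \<Longrightarrow> M a b = M b a"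
    and neg: "(\<Sum>a\<in>F. \<Sum>b\<in>F. v a * v b * M a b) < 0"
  obtains m w a where "0 < m" "a \<in> F" "w a \<noteq> 0"
    "\<And>a. a \<in> F \<Longrightarrow> (\<Sum>b\<in>F. M a b * w b) = - m * w a"
proof -
  define Q where "Q w = (\<Sum>a\<in>F. \<Sum>b\<in>F. w a * w b * M a b)" for w :: "'a \<Rightarrow> real"
  define N where "N w = (\<Sum>a\<in>F. (w a)\<^sup>2)" for w :: "'a \<Rightarrow> real"
  \<comment> \<open>\<open>Q\<close> and \<open>N\<close> see only the values on \<open>F\<close>.
    Pinning the others to 0 gives a product of compact sets, so Tychonoff's theorem applies even if
    the index type is infinite.\<close>
  define B where "B = (\<Pi>\<^sub>E a\<in>UNIV. if a \<in> F then {-1..1::real} else {0})"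
  define K where "K = B \<inter> {w. N w = 1}"
  have scale: "Q (\<lambda>a. s * w a) = s\<^sup>2 * Q w" "N (\<lambda>a. s * w a) = s\<^sup>2 * N w" for s w
    unfolding Q_def N_def by (simp_all add: sum_distrib_left power2_eq_square mult_ac)
  have coord: "continuous_on S (\<lambda>w :: 'a \<Rightarrow> real. w a)" for S a
    by (rule continuous_on_subset[OF continuous_on_product_coordinates]) simp
  have contN: "continuous_on S N" and contQ: "continuous_on S Q" for S
    unfolding N_def Q_def by (intro continuous_intros coord)+
  have "compactin (product_topology (\<lambda>_. euclidean) UNIV) B"
    unfolding B_def by (subst compactin_PiE) auto
  then have compB: "compact B"
    by (simp add: euclidean_product_topology)
  have "closed {w. N w = 1}"
    by (intro closed_Collect_eq contN continuous_on_const)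
  then have compK: "compact K"
    unfolding K_def by (intro compact_Int_closed compB)
  have normalise: "Q w / N w \<in> Q ` K" if "N w \<noteq> 0" for w
  proof -
    have Npos: "N w > 0" using that sum_nonneg[of F "\<lambda>a. (w a)\<^sup>2"] by (simp add: N_def)
    define w' where "w' a = (if a \<in> F then w a / sqrt (N w) else 0)" for a
    have eq: "Q w' = Q (\<lambda>a. (1 / sqrt (N w)) * w a)" "N w' = N (\<lambda>a. (1 / sqrt (N w)) * w a)"
      by (auto simp: Q_def N_def w'_def intro!: sum.cong)
    have N1: "N w' = 1" unfolding eq scale using Npos by (simp add: power_divide)
    have "\<bar>w' a\<bar> \<le> 1" if "a \<in> F" for a
      using member_le_sum[of a F "\<lambda>a. (w' a)\<^sup>2"] that F N1 by (simp add: N_def abs_square_le_1)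
    then have "w' a \<in> (if a \<in> F then {-1..1} else {0})" for a
      by (cases "a \<in> F") (auto simp: abs_le_iff minus_le_iff, simp add: w'_def)
    then have "w' \<in> B" unfolding B_def by (intro PiE_I) auto
    moreover have "Q w' = Q w / N w"
      unfolding eq scale using Npos by (simp add: power_divide)
    ultimately show ?thesis using N1 by (force simp: K_def)
  qed
  have vN: "N v \<noteq> 0"
  proof
    assume "N v = 0"
    then have "\<forall>a\<in>F. v a = 0" using F by (simp add: N_def sum_nonneg_eq_0_iff)
    then show False using neg by simp
  qed
  then have "K \<noteq> {}" using normalise by blast
  then obtain w where w: "w \<in> K" and min: "\<And>u. u \<in> K \<Longrightarrow> Q w \<le> Q u"
    using continuous_attains_inf[OF compK _ contQ] by blast
  have Nw: "N w = 1" using w by (simp add: K_def)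
  have min': "Q w * N u \<le> Q u" for u
  proof (cases "N u = 0")
    case True
    then have "\<forall>a\<in>F. u a = 0" using F by (simp add: N_def sum_nonneg_eq_0_iff)
    then show ?thesis using True by (simp add: Q_def)
  next
    case False
    then have "N u > 0" using sum_nonneg[of F "\<lambda>a. (u a)\<^sup>2"] by (simp add: N_def)
    moreover have "Q w \<le> Q u / N u" using normalise[OF False] min by force
    ultimately show ?thesis by (simp add: field_simps)
  qed
  have "Q v < 0" using neg by (simp add: Q_def)
  moreover have "N v > 0" using vN sum_nonneg[of F "\<lambda>a. (v a)\<^sup>2"] by (simp add: N_def)
  ultimately have "Q w * N v < 0" using min'[of v] by linarith
  then have m: "- Q w > 0" using \<open>N v > 0\<close> by (simp add: mult_less_0_iff)
  have eig: "(\<Sum>b\<in>F. M c b * w b) = - (- Q w) * w c" if c: "c \<in> F" for c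
  proof -
    \<comment> \<open>By \<open>min'\<close> the form \<open>Q u - Q w * N u\<close> is nonnegative,
      and it vanishes at \<open>u = w\<close>, so its derivative there along coordinate
      \<open>c\<close> is zero.\<close>
    have "(\<Sum>b\<in>F. M c b * w b) - Q w * w c = 0"
    proof (rule linear_coeff_zero)
      fix t
      let ?u = "\<lambda>a. w a + (if a = c then t else 0)"
      have "N ?u = (\<Sum>a\<in>F. (w a)\<^sup>2 + (if a = c then 2 * t * w a + t\<^sup>2 else 0))"
        unfolding N_def by (intro sum.cong) (auto simp: power2_sum)
      also have "\<dots> = 1 + 2 * t * w c + t\<^sup>2"
        using F c Nw by (simp add: sum.distrib N_def)
      finally have N: "N ?u = 1 + 2 * t * w c + t\<^sup>2" .
      have Q: "Q ?u = Q w + 2 * t * (\<Sum>b\<in>F. M c b * w b) + t\<^sup>2 * M c c"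
        unfolding Q_def by (rule quadratic_form_add_single[OF F sym c])
      show "0 \<le> 2 * t * ((\<Sum>b\<in>F. M c b * w b) - Q w * w c) + t\<^sup>2 * (M c c - Q w)"
        using min'[of ?u] unfolding N Q by (simp add: algebra_simps)
    qed
    then show ?thesis by simp
  qed
  obtain a where "a \<in> F" "w a \<noteq> 0"
    using Nw by (auto simp: N_def) (metis (mono_tags, lifting) sum.neutral zero_neq_one zero_power2)
  with m eig that show thesis by blast
qed

text \<open>
  An eigenvector for a negative eigenvalue may be averaged over a symmetry group fixing a point of
  its support, so nonnegativity needs to be tested on invariant vectors only.
\<close>

lemma quadratic_form_nonneg_by_averaging:
  fixes M :: "'a \<Rightarrow> 'a \<Rightarrow> real" and G :: "'a \<Rightarrow> ('a \<Rightarrow> 'a) set"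
  assumes F: "finite F" and sym: "\<And>a b. a \<in> F \<Longrightarrow> b \<in> F \<Longrightarrow> M a b = M b a"
    and G: "\<And>c. c \<in> F \<Longrightarrow> finite (G c)" "\<And>c. c \<in> F \<Longrightarrow> id \<in> G c"
    and comp: "\<And>c g h. c \<in> F \<Longrightarrow> g \<in> G c \<Longrightarrow> h \<in> G c \<Longrightarrow> h \<circ> g \<in> G c"
    and bij: "\<And>c g. c \<in> F \<Longrightarrow> g \<in> G c \<Longrightarrow> bij g"
    and maps: "\<And>c g. c \<in> F \<Longrightarrow> g \<in> G c \<Longrightarrow> g ` F = F"
    and fix_point: "\<And>c g. c \<in> F \<Longrightarrow> g \<in> G c \<Longrightarrow> g c = c"
    and invariant: "\<And>c g a b. c \<in> F \<Longrightarrow> g \<in> G c \<Longrightarrow> a \<in> F \<Longrightarrow> b \<in> F \<Longrightarrow> M (g a) (g b) = M a b"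
    and nonneg: "\<And>c w. c \<in> F \<Longrightarrow> (\<And>g a. g \<in> G c \<Longrightarrow> a \<in> F \<Longrightarrow> w (g a) = w a) \<Longrightarrow>
      0 \<le> (\<Sum>a\<in>F. \<Sum>b\<in>F. w a * w b * M a b)"
  shows "0 \<le> (\<Sum>a\<in>F. \<Sum>b\<in>F. v a * v b * M a b)"
proof (rule ccontr)
  assume "\<not> ?thesis"
  then have neg: "(\<Sum>a\<in>F. \<Sum>b\<in>F. v a * v b * M a b) < 0" by simp
  obtain m w c where m: "0 < m" and c: "c \<in> F" "w c \<noteq> 0"
    and eig: "\<And>a. a \<in> F \<Longrightarrow> (\<Sum>b\<in>F. M a b * w b) = - m * w a"
  proof (rule negative_eigenvector[OF F sym neg])
    fix m w a
    assume "0 < m" "a \<in> F" "w a \<noteq> 0" "\<And>a. a \<in> F \<Longrightarrow> (\<Sum>b\<in>F. M a b * w b) = - m * w a"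
    then show thesis by (rule that)
  qed
  \<comment> \<open>Summing over maps that move \<open>c\<close> could cancel; as every element of
    \<open>G c\<close> fixes \<open>c\<close>, the value at \<open>c\<close> is only multiplied by
    \<open>card (G c)\<close>.\<close>
  define u where "u a = (\<Sum>g\<in>G c. w (g a))" for a
  have uc: "u c = card (G c) * w c" by (simp add: u_def fix_point[OF c(1)])
  have uinv: "u (g a) = u a" if g: "g \<in> G c" for g a
  proof -
    have inj: "inj_on (\<lambda>h. h \<circ> g) (G c)"
    proof (rule inj_onI)
      fix h h' assume "h \<circ> g = h' \<circ> g"
      then have "h \<circ> (g \<circ> inv g) = h' \<circ> (g \<circ> inv g)" by (simp only: comp_assoc[symmetric])
      then show "h = h'" using bij[OF c(1) g] by (simp add: surj_iff[THEN iffD1] bij_is_surj)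
    qed
    have "(\<lambda>h. h \<circ> g) ` G c \<subseteq> G c" using comp[OF c(1) g] by blast
    then have img: "(\<lambda>h. h \<circ> g) ` G c = G c"
      by (rule endo_inj_surj[OF G(1)[OF c(1)] _ inj])
    have "u a = (\<Sum>h\<in>(\<lambda>h. h \<circ> g) ` G c. w (h a))" by (simp add: u_def img)
    also have "\<dots> = u (g a)" using inj by (simp add: sum.reindex u_def)
    finally show ?thesis by simp
  qed
  have ueig: "(\<Sum>b\<in>F. M a b * u b) = - m * u a" if a: "a \<in> F" for a
  proof -
    have "(\<Sum>b\<in>F. M a b * u b) = (\<Sum>g\<in>G c. \<Sum>b\<in>F. M a b * w (g b))"
      unfolding u_def sum_distrib_left by (rule sum.swap)
    also have "\<dots> = (\<Sum>g\<in>G c. - m * w (g a))"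
    proof (rule sum.cong[OF refl])
      fix g assume g: "g \<in> G c"
      have inj: "inj_on g F" using bij[OF c(1) g] by (auto dest: bij_is_inj intro: inj_on_subset)
      have "(\<Sum>b\<in>F. M a b * w (g b)) = (\<Sum>b\<in>F. M (g a) (g b) * w (g b))"
        by (intro sum.cong refl) (simp add: invariant[OF c(1) g a])
      also have "\<dots> = (\<Sum>b\<in>g ` F. M (g a) b * w b)" using inj by (simp add: sum.reindex)
      also have "\<dots> = - m * w (g a)" using maps[OF c(1) g] a eig by auto
      finally show "(\<Sum>b\<in>F. M a b * w (g b)) = - m * w (g a)" .
    qed
    finally show ?thesis by (simp add: u_def sum_distrib_left)
  qed
  have "0 \<le> (\<Sum>a\<in>F. \<Sum>b\<in>F. u a * u b * M a b)" by (rule nonneg[OF c(1)]) (rule uinv)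
  also have "\<dots> = (\<Sum>a\<in>F. u a * (\<Sum>b\<in>F. M a b * u b))" by (simp add: sum_distrib_left mult_ac)
  also have "\<dots> = (\<Sum>a\<in>F. u a * (- m * u a))"
    by (intro sum.cong refl) (simp only: ueig)
  also have "\<dots> = - m * (\<Sum>a\<in>F. (u a)\<^sup>2)"
    by (simp only: sum_distrib_left power2_eq_square mult_ac)
  finally have "(\<Sum>a\<in>F. (u a)\<^sup>2) \<le> 0" using m by (simp add: mult_le_0_iff)
  moreover have "(u c)\<^sup>2 \<le> (\<Sum>a\<in>F. (u a)\<^sup>2)" using F c by (intro member_le_sum) auto
  ultimately have "u c = 0" by (smt (verit) zero_less_power2)
  then show False using uc c G[OF c(1)] by auto
qed

text \<open>Dominance relative to the diagonal: after scaling coordinate \<open>r\<close> by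
  \<open>sqrt (H r r)\<close>, all off-diagonal entries are at most \<open>1 / k\<close> and there
  are at most \<open>k\<close> rows. The scaling matters because the diagonal entries will have
  different orders of magnitude in \<open>n\<close>.\<close>

lemma diagonally_dominant_nonneg:
  fixes H :: "'a \<Rightarrow> 'a \<Rightarrow> real"
  assumes R: "finite R" "real (card R) \<le> k" and diag: "\<And>r. r \<in> R \<Longrightarrow> 0 \<le> H r r"
    and off: "\<And>r s. r \<in> R \<Longrightarrow> s \<in> R \<Longrightarrow> r \<noteq> s \<Longrightarrow> k * \<bar>H r s\<bar> \<le> sqrt (H r r) * sqrt (H s s)"
  shows "0 \<le> (\<Sum>r\<in>R. \<Sum>s\<in>R. w r * w s * H r s)"
proof (cases "R = {}")
  case False
  then have k: "k > 0" using R card_gt_0_iff[of R] by linarith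
  define X where "X r = (w r)\<^sup>2 * H r r" for r
  have X0: "X r \<ge> 0" if "r \<in> R" for r using diag[OF that] by (simp add: X_def)
  have entry: "(if r = s then X r else 0) - (X r + X s) / (2 * k) \<le> w r * w s * H r s"
    if rs: "r \<in> R" "s \<in> R" for r s
  proof (cases "r = s")
    case True
    then show ?thesis using X0[OF rs(1)] k by (simp add: X_def power2_eq_square)
  next
    case False
    have "k * \<bar>w r * w s * H r s\<bar> = \<bar>w r\<bar> * \<bar>w s\<bar> * (k * \<bar>H r s\<bar>)" by (simp add: abs_mult)
    also have "\<dots> \<le> \<bar>w r\<bar> * \<bar>w s\<bar> * (sqrt (H r r) * sqrt (H s s))"
      by (intro mult_left_mono off rs False) auto
    also have "\<dots> = (\<bar>w r\<bar> * sqrt (H r r)) * (\<bar>w s\<bar> * sqrt (H s s))" by simp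
    also have "\<dots> \<le> ((\<bar>w r\<bar> * sqrt (H r r))\<^sup>2 + (\<bar>w s\<bar> * sqrt (H s s))\<^sup>2) / 2"
      using sum_squares_bound[of "\<bar>w r\<bar> * sqrt (H r r)" "\<bar>w s\<bar> * sqrt (H s s)"] by simp
    also have "\<dots> = (X r + X s) / 2" using diag rs by (simp add: X_def power_mult_distrib)
    finally have "\<bar>w r * w s * H r s\<bar> \<le> (X r + X s) / (2 * k)" using k by (simp add: field_simps)
    then show ?thesis using False by simp
  qed
  have "0 \<le> (\<Sum>r\<in>R. X r) - card R / k * (\<Sum>r\<in>R. X r)"
  proof -
    have "card R / k * (\<Sum>r\<in>R. X r) \<le> 1 * (\<Sum>r\<in>R. X r)"
      using R k X0 by (intro mult_right_mono sum_nonneg) auto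
    then show ?thesis by simp
  qed
  also have "\<dots> = (\<Sum>r\<in>R. \<Sum>s\<in>R. (if r = s then X r else 0) - (X r + X s) / (2 * k))"
  proof -
    have "(\<Sum>r\<in>R. \<Sum>s\<in>R. X r + X s) = 2 * (card R * (\<Sum>r\<in>R. X r))"
      by (simp add: sum.distrib sum_distrib_left)
    then have "(\<Sum>r\<in>R. \<Sum>s\<in>R. (X r + X s) / (2 * k)) = card R / k * (\<Sum>r\<in>R. X r)"
      by (simp add: sum_divide_distrib[symmetric])
    then show ?thesis using R by (simp add: sum_subtractf)
  qed
  also have "\<dots> \<le> (\<Sum>r\<in>R. \<Sum>s\<in>R. w r * w s * H r s)"
    by (intro sum_mono entry)
  finally show ?thesis .
qed simp

lemma sum_over_pairs_by_key:
  fixes M :: "'a \<Rightarrow> 'a \<Rightarrow> real"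
  assumes F: "finite F"
  shows "(\<Sum>a\<in>F. \<Sum>b\<in>F. w (key a) * w (key b) * M a b) =
    (\<Sum>r\<in>key ` F. \<Sum>s\<in>key ` F. w r * w s * (\<Sum>a\<in>{a\<in>F. key a = r}. \<Sum>b\<in>{b\<in>F. key b = s}. M a b))"
proof -
  have "(\<Sum>a\<in>F. \<Sum>b\<in>F. w (key a) * w (key b) * M a b) =
      (\<Sum>r\<in>key ` F. \<Sum>a\<in>{a\<in>F. key a = r}. \<Sum>b\<in>F. w (key a) * w (key b) * M a b)"
    by (rule sum.image_gen[OF F])
  also have "\<dots> = (\<Sum>r\<in>key ` F. \<Sum>a\<in>{a\<in>F. key a = r}. \<Sum>s\<in>key ` F. \<Sum>b\<in>{b\<in>F. key b = s}. w r * w s * M a b)"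
    by (intro sum.cong refl, subst sum.image_gen[OF F, of _ key]) auto
  also have "\<dots> = (\<Sum>r\<in>key ` F. \<Sum>s\<in>key ` F. \<Sum>a\<in>{a\<in>F. key a = r}. \<Sum>b\<in>{b\<in>F. key b = s}. w r * w s * M a b)"
    by (intro sum.cong refl sum.swap)
  finally show ?thesis by (simp add: sum_distrib_left)
qed

section \<open>A symmetric functional on polynomials\<close>

definition shape :: "nat set \<Rightarrow> (nat \<Rightarrow> nat) \<Rightarrow> nat multiset" where
  "shape S c = filter_mset (\<lambda>r. 0 < r) (image_mset c (mset_set S))"

lemma shape_empty [simp]: "shape {} c = {#}"
  by (simp add: shape_def)

lemma shape_insert:
  "finite S \<Longrightarrow> i \<notin> S \<Longrightarrow> shape (insert i S) c = (if c i = 0 then shape S c else add_mset (c i) (shape S c))"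
  by (simp add: shape_def)

lemma shape_union:
  "finite S \<Longrightarrow> finite S' \<Longrightarrow> S \<inter> S' = {} \<Longrightarrow> shape (S \<union> S') c = shape S c + shape S' c"
  by (simp add: shape_def mset_set_Union)

lemma shape_cong: "(\<And>i. i \<in> S \<Longrightarrow> c i = c' i) \<Longrightarrow> shape S c = shape S c'"
  unfolding shape_def
  by (rule arg_cong[of _ _ "filter_mset _"], rule image_mset_cong)
     (metis elem_mset_set equals0D finite_set_mset mset_set.infinite set_mset_empty)

lemma in_shape_iff: "finite S \<Longrightarrow> r \<in># shape S c \<longleftrightarrow> 0 < r \<and> (\<exists>i\<in>S. r = c i)"
  by (auto simp: shape_def)

lemma size_shape: "finite S \<Longrightarrow> size (shape S c) = card {i\<in>S. c i \<noteq> 0}"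
proof (induction S rule: finite_induct)
  case (insert x S)
  have "{i\<in>insert x S. c i \<noteq> 0} = (if c x = 0 then {i\<in>S. c i \<noteq> 0} else insert x {i\<in>S. c i \<noteq> 0})" by auto
  then show ?case using insert by (simp add: shape_insert)
qed simp

lemma sum_mset_shape: "finite S \<Longrightarrow> sum_mset (shape S c) = sum c S"
  by (induction S rule: finite_induct) (auto simp: shape_insert)

lemma size_le_sum_mset: "\<forall>r\<in>#M. 0 < r \<Longrightarrow> size M \<le> sum_mset M" for M :: "nat multiset"
  by (induction M) auto

lemma shape_zero: "\<forall>i\<in>S. c i = 0 \<Longrightarrow> shape S c = {#}"
  by (metis in_shape_iff finite.emptyI less_irrefl mset_set.infinite multiset_nonemptyE shape_def
      image_mset_empty filter_empty_mset)

lemma shape_remove: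
  assumes "finite S" "i \<in> S"
  shows "shape S c = (if c i = 0 then shape (S - {i}) c else add_mset (c i) (shape (S - {i}) c))"
  using shape_insert[of "S - {i}" i c] assms by (simp add: insert_absorb)

definition merge_monotone :: "nat \<Rightarrow> (nat multiset \<Rightarrow> real) \<Rightarrow> bool" where
  "merge_monotone k z \<longleftrightarrow> (\<forall>a b mu. add_mset a (add_mset b mu) \<in> even_partitions k \<longrightarrow>
     z (add_mset (a + b) mu) \<le> z (add_mset a (add_mset b mu)))"

lemma merge_monotoneD:
  "merge_monotone k z \<Longrightarrow> add_mset a (add_mset b mu) \<in> even_partitions k \<Longrightarrow>
    z (add_mset (a + b) mu) \<le> z (add_mset a (add_mset b mu))"
  by (simp add: merge_monotone_def)

lemma even_partitions_merge:
  "add_mset a (add_mset b mu) \<in> even_partitions k \<Longrightarrow> add_mset (a + b) mu \<in> even_partitions k"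
  by (auto simp: even_partitions_def)

text \<open>Adding two exponent vectors merges two parts at each index where both are positive. The
  induction performs one merge at a time, and \<open>mu\<close> collects the parts of the indices
  already treated.\<close>

lemma shape_add_le:
  assumes z: "merge_monotone k z" and "finite S" and "mu + shape S f + shape S g \<in> even_partitions k"
  shows "z (mu + shape S (\<lambda>i. f i + g i)) \<le> z (mu + shape S f + shape S g) \<and>
    mu + shape S (\<lambda>i. f i + g i) \<in> even_partitions k"
  using assms(2,3)
proof (induction S arbitrary: mu rule: finite_induct)
  case (insert i S)
  consider "f i = 0" "g i = 0" | "f i > 0" "g i = 0" | "f i = 0" "g i > 0" | "f i > 0" "g i > 0" by blast
  then show ?case
  proof cases
    case 1
    then show ?thesis using insert by (simp add: shape_insert)
  next
    case 2
    then show ?thesis using insert.IH[of "add_mset (f i) mu"] insert by (simp add: shape_insert)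
  next
    case 3
    then show ?thesis using insert.IH[of "add_mset (g i) mu"] insert by (simp add: shape_insert)
  next
    case 4
    let ?m = "mu + shape S f + shape S g"
    have e: "add_mset (f i) (add_mset (g i) ?m) \<in> even_partitions k"
      using 4 insert by (simp add: shape_insert add_mset_commute)
    have "z (add_mset (f i + g i) ?m) \<le> z (add_mset (f i) (add_mset (g i) ?m))"
      by (rule merge_monotoneD[OF z e])
    then show ?thesis
      using insert.IH[of "add_mset (f i + g i) mu"] even_partitions_merge[OF e] 4 insert
      by (simp add: shape_insert add_mset_commute)
  qed
qed simp

text \<open>
  The moments of a symmetric functional: a monomial with all exponents even, of shape \<open>mu\<close>, has
  moment \<open>n powr (z mu - size mu)\<close>. The factor \<open>n powr - size mu\<close> compensates the number of
  monomials of that shape, so that \<open>p\<^sub>\<lambda>\<close> has moment of order \<open>n powr z \<lambda>\<close>.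
\<close>

definition weight :: "nat \<Rightarrow> (nat multiset \<Rightarrow> real) \<Rightarrow> nat multiset \<Rightarrow> real" where
  "weight n z mu = (if \<forall>r\<in>#mu. even r then real n powr (z mu - size mu) else 0)"

definition moment :: "nat \<Rightarrow> (nat multiset \<Rightarrow> real) \<Rightarrow> rpoly \<Rightarrow> real" where
  "moment n z p = (\<Sum>m\<in>Poly_Mapping.keys p. Poly_Mapping.lookup p m *
     weight n z (shape {..<n} (Poly_Mapping.lookup m)))"

lemma weight_nonneg [simp]: "0 \<le> weight n z mu"
  by (simp add: weight_def)

section \<open>Linearity of the moment functional\<close>

lemma moment_superset:
  assumes "finite A" "Poly_Mapping.keys p \<subseteq> A"
  shows "moment n z p = (\<Sum>m\<in>A. Poly_Mapping.lookup p m * weight n z (shape {..<n} (Poly_Mapping.lookup m)))"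
  unfolding moment_def using assms by (intro sum.mono_neutral_left) (auto simp: in_keys_iff)

lemma moment_add: "moment n z (p + q) = moment n z p + moment n z q"
proof -
  let ?A = "Poly_Mapping.keys p \<union> Poly_Mapping.keys q"
  have "Poly_Mapping.keys (p + q) \<subseteq> ?A" by (rule Poly_Mapping.keys_add)
  then show ?thesis
    by (simp add: moment_superset[of ?A] lookup_add sum.distrib[symmetric] algebra_simps)
qed

lemma moment_zero [simp]: "moment n z 0 = 0"
  by (simp add: moment_def)

lemma moment_sum: "moment n z (sum f A) = (\<Sum>a\<in>A. moment n z (f a))"
  by (induction A rule: infinite_finite_induct) (simp_all add: moment_add)

lemma moment_single:
  "moment n z (Poly_Mapping.single m a) = a * weight n z (shape {..<n} (Poly_Mapping.lookup m))"
  by (simp add: moment_def)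

lemma sum_single_lookup:
  "(p :: 'a \<Rightarrow>\<^sub>0 'b::comm_monoid_add) = (\<Sum>m\<in>Poly_Mapping.keys p. Poly_Mapping.single m (Poly_Mapping.lookup p m))"
  by (rule poly_mapping_eqI)
     (simp add: lookup_sum lookup_single when_def in_keys_iff)

lemma mult_eq_sum_single:
  fixes p q :: rpoly
  shows "p * q = (\<Sum>a\<in>Poly_Mapping.keys p. \<Sum>b\<in>Poly_Mapping.keys q.
    Poly_Mapping.single (a + b) (Poly_Mapping.lookup p a * Poly_Mapping.lookup q b))"
  by (subst sum_single_lookup[of p], subst sum_single_lookup[of q])
     (simp only: sum_product mult_single)

lemma moment_mult:
  "moment n z (p * q) = (\<Sum>a\<in>Poly_Mapping.keys p. \<Sum>b\<in>Poly_Mapping.keys q.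
     Poly_Mapping.lookup p a * Poly_Mapping.lookup q b * weight n z (shape {..<n} (Poly_Mapping.lookup (a + b))))"
  unfolding mult_eq_sum_single[of p q] by (simp only: moment_sum moment_single)

lemma moment_Const: "moment n z (Const a * p) = a * moment n z p"
  unfolding moment_mult by (simp add: Const_def moment_def sum_distrib_left mult_ac)

lemma moment_sum_list: "moment n z (\<Sum>q\<leftarrow>qs. f q) = (\<Sum>q\<leftarrow>qs. moment n z (f q))"
  by (induction qs) (simp_all add: moment_add)

lemma Var_power: "Var i ^ r = Poly_Mapping.single (Poly_Mapping.single i r) 1"
  by (induction r) (auto simp: Var_def mult_single single_add[symmetric] single_one[symmetric] simp del: single_one)

lemma power_sum_product_add_mset [simp]:
  "power_sum_product n (add_mset r l) = power_sum n r * power_sum_product n l"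
  by (simp add: power_sum_product_def)

lemma power_sum_product_empty [simp]: "power_sum_product n {#} = 1"
  by (simp add: power_sum_product_def)

text \<open>The recursion behind both growth bounds: expanding one power sum multiplies the monomial
  in front by one more variable power.\<close>

lemma moment_single_power_sum_product:
  "moment n z (Poly_Mapping.single b 1 * power_sum_product n (add_mset r l)) =
    (\<Sum>i<n. moment n z (Poly_Mapping.single (b + Poly_Mapping.single i r) 1 * power_sum_product n l))"
proof -
  have "Poly_Mapping.single b 1 * power_sum_product n (add_mset r l) =
      (\<Sum>i<n. Poly_Mapping.single (b + Poly_Mapping.single i r) 1 * power_sum_product n l)"
    by (simp add: power_sum_def Var_power sum_distrib_left sum_distrib_right mult_single mult.assoc[symmetric])
  then show ?thesis by (simp only: moment_sum)
qed

lemma moment_single_power_sum_product_nonneg: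
  "0 \<le> moment n z (Poly_Mapping.single b 1 * power_sum_product n l)"
proof (induction l arbitrary: b)
  case empty
  then show ?case by (simp add: moment_single)
next
  case (add r l)
  then show ?case unfolding moment_single_power_sum_product by (intro sum_nonneg)
qed

lemma shape_add_single:
  assumes "i < n" "0 < r"
  shows "shape {..<n} (Poly_Mapping.lookup (b + Poly_Mapping.single i r)) =
    (if Poly_Mapping.lookup b i = 0 then add_mset r (shape {..<n} (Poly_Mapping.lookup b))
     else add_mset (Poly_Mapping.lookup b i + r) (shape {..<n} (Poly_Mapping.lookup b) - {#Poly_Mapping.lookup b i#}))"
proof -
  have "shape ({..<n} - {i}) (Poly_Mapping.lookup (b + Poly_Mapping.single i r)) =
      shape ({..<n} - {i}) (Poly_Mapping.lookup b)"
    by (rule shape_cong) (auto simp: lookup_add lookup_single)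
  then show ?thesis
    using assms shape_remove[of "{..<n}" i "Poly_Mapping.lookup b"]
      shape_remove[of "{..<n}" i "Poly_Mapping.lookup (b + Poly_Mapping.single i r)"]
    by (simp add: lookup_add lookup_single)
qed

lemma size_even_partition_le: "l \<in> even_partitions k \<Longrightarrow> size l \<le> k"
  using size_le_sum_mset[of l] by (auto simp: even_partitions_def)

lemma card_support_le:
  assumes "shape {..<n} c + l \<in> even_partitions k"
  shows "card {i\<in>{..<n}. c i \<noteq> 0} \<le> k"
  using size_even_partition_le[OF assms] by (simp add: size_shape)

text \<open>A new factor X_i^r either meets one of the at most \<open>k\<close> variables already
  present, where a merge does not raise \<open>z\<close> and the size stays the same, or one of at
  most \<open>n\<close> fresh variables, where the loss of a factor \<open>n\<close> is made up by
  the number of choices. So every power sum costs at most \<open>k + 1\<close>.\<close>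

lemma moment_power_sum_product_upper:
  fixes z :: "nat multiset \<Rightarrow> real"
  assumes z: "merge_monotone k z" and n: "0 < n"
    and "shape {..<n} (Poly_Mapping.lookup b) + l \<in> even_partitions k"
  shows "moment n z (Poly_Mapping.single b 1 * power_sum_product n l) \<le>
    (real k + 1) ^ size l * n powr (z (shape {..<n} (Poly_Mapping.lookup b) + l) - size (shape {..<n} (Poly_Mapping.lookup b)))"
  using assms(3)
proof (induction l arbitrary: b)
  case empty
  then show ?case by (simp add: moment_single weight_def)
next
  case (add r l)
  let ?c = "Poly_Mapping.lookup b" and ?b = "\<lambda>i. b + Poly_Mapping.single i r"
  let ?s = "shape {..<n} ?c"
  define A where "A = (real k + 1) ^ size l"
  define e where "e = z (?s + add_mset r l) - size ?s"
  have r: "0 < r" using add.prems by (auto simp: even_partitions_def)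
  have on: "moment n z (Poly_Mapping.single (?b i) 1 * power_sum_product n l) \<le> A * n powr e"
    if i: "i < n" "?c i \<noteq> 0" for i
  proof -
    obtain s' where s': "?s = add_mset (?c i) s'"
      using shape_remove[of "{..<n}" i ?c] i by auto
    have sh: "shape {..<n} (Poly_Mapping.lookup (?b i)) = add_mset (?c i + r) s'"
      using i r by (subst shape_add_single) (auto simp: s')
    have ep: "add_mset (?c i) (add_mset r (s' + l)) \<in> even_partitions k"
      using add.prems by (simp add: s' add_mset_commute)
    have "z (add_mset (?c i + r) (s' + l)) \<le> z (add_mset (?c i) (add_mset r (s' + l)))"
      by (rule merge_monotoneD[OF z ep])
    then have le: "z (add_mset (?c i + r) (s' + l)) - (real (size s') + 1) \<le> e"
      by (simp add: e_def s' add_mset_commute)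
    have "moment n z (Poly_Mapping.single (?b i) 1 * power_sum_product n l) \<le>
        A * n powr (z (add_mset (?c i + r) (s' + l)) - (real (size s') + 1))"
      using add.IH[of "?b i"] even_partitions_merge[OF ep] by (simp add: sh A_def add_ac)
    also have "\<dots> \<le> A * n powr e"
      using n le by (intro mult_left_mono powr_mono) (auto simp: A_def)
    finally show ?thesis .
  qed
  have off: "moment n z (Poly_Mapping.single (?b i) 1 * power_sum_product n l) \<le> A * n powr (e - 1)"
    if i: "i < n" "?c i = 0" for i
  proof -
    have sh: "shape {..<n} (Poly_Mapping.lookup (?b i)) = add_mset r ?s"
      using i r by (subst shape_add_single) auto
    show ?thesis
      using add.IH[of "?b i"] add.prems by (simp add: sh A_def e_def algebra_simps)
  qed
  have "moment n z (Poly_Mapping.single b 1 * power_sum_product n (add_mset r l)) =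
      (\<Sum>i\<in>{i\<in>{..<n}. ?c i \<noteq> 0} \<union> {i\<in>{..<n}. ?c i = 0}. moment n z (Poly_Mapping.single (?b i) 1 * power_sum_product n l))"
    unfolding moment_single_power_sum_product by (intro sum.cong) auto
  also have "\<dots> = (\<Sum>i\<in>{i\<in>{..<n}. ?c i \<noteq> 0}. moment n z (Poly_Mapping.single (?b i) 1 * power_sum_product n l))
     + (\<Sum>i\<in>{i\<in>{..<n}. ?c i = 0}. moment n z (Poly_Mapping.single (?b i) 1 * power_sum_product n l))"
    by (rule sum.union_disjoint) auto
  also have "\<dots> \<le> card {i\<in>{..<n}. ?c i \<noteq> 0} * (A * n powr e) + card {i\<in>{..<n}. ?c i = 0} * (A * n powr (e - 1))"
    by (intro add_mono sum_bounded_above on off) auto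
  also have "\<dots> \<le> k * (A * n powr e) + n * (A * n powr (e - 1))"
    using card_support_le[OF add.prems] card_mono[of "{..<n}" "{i\<in>{..<n}. ?c i = 0}"]
    by (intro add_mono mult_right_mono) (auto simp: A_def)
  also have "n * (A * n powr (e - 1)) = A * n powr e"
    using n by (simp add: powr_diff)
  finally show ?case by (simp add: A_def e_def algebra_simps)
qed

text \<open>All terms are nonnegative, so it suffices to count the fresh variables. At most
  \<open>k\<close> \<le> \<open>n / 2\<close> are taken, hence every power sum costs at most a
  factor 1/2.\<close>

lemma moment_power_sum_product_lower:
  fixes z :: "nat multiset \<Rightarrow> real"
  assumes n: "0 < n" "2 * k \<le> n"
    and "shape {..<n} (Poly_Mapping.lookup b) + l \<in> even_partitions k"
  shows "moment n z (Poly_Mapping.single b 1 * power_sum_product n l) \<ge>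
    (1 / 2) ^ size l * n powr (z (shape {..<n} (Poly_Mapping.lookup b) + l) - size (shape {..<n} (Poly_Mapping.lookup b)))"
  using assms(3)
proof (induction l arbitrary: b)
  case empty
  then show ?case by (auto simp: moment_single weight_def even_partitions_def)
next
  case (add r l)
  let ?c = "Poly_Mapping.lookup b" and ?b = "\<lambda>i. b + Poly_Mapping.single i r"
  let ?s = "shape {..<n} ?c" and ?Z = "{i\<in>{..<n}. Poly_Mapping.lookup b i = 0}"
  define A :: real where "A = (1 / 2) ^ size l"
  define e where "e = z (?s + add_mset r l) - size ?s"
  have r: "0 < r" using add.prems by (auto simp: even_partitions_def)
  have off: "A * n powr (e - 1) \<le> moment n z (Poly_Mapping.single (?b i) 1 * power_sum_product n l)"
    if i: "i \<in> ?Z" for i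
  proof -
    have sh: "shape {..<n} (Poly_Mapping.lookup (?b i)) = add_mset r ?s"
      using i r by (subst shape_add_single) auto
    show ?thesis
      using add.IH[of "?b i"] add.prems by (simp add: sh A_def e_def algebra_simps)
  qed
  have "card (?Z \<union> {i\<in>{..<n}. ?c i \<noteq> 0}) = card ?Z + card {i\<in>{..<n}. ?c i \<noteq> 0}"
    by (rule card_Un_disjoint) auto
  moreover have "?Z \<union> {i\<in>{..<n}. ?c i \<noteq> 0} = {..<n}" by auto
  ultimately have "card ?Z + card {i\<in>{..<n}. ?c i \<noteq> 0} = n" by simp
  then have Z: "n / 2 \<le> card ?Z"
    using card_support_le[OF add.prems] n by simp
  have "(1 / 2) ^ size (add_mset r l) * n powr e = n / 2 * (A * n powr (e - 1))"
    using n by (simp add: A_def powr_diff)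
  also have "\<dots> \<le> card ?Z * (A * n powr (e - 1))"
    by (intro mult_right_mono Z) (simp add: A_def)
  also have "\<dots> \<le> (\<Sum>i\<in>?Z. moment n z (Poly_Mapping.single (?b i) 1 * power_sum_product n l))"
    by (intro sum_bounded_below off)
  also have "\<dots> \<le> (\<Sum>i<n. moment n z (Poly_Mapping.single (?b i) 1 * power_sum_product n l))"
    by (intro sum_mono2 moment_single_power_sum_product_nonneg) auto
  finally show ?case unfolding moment_single_power_sum_product e_def .
qed

lemma moment_power_sum_product_bounds:
  fixes z :: "nat multiset \<Rightarrow> real"
  assumes z: "merge_monotone k z" and n: "0 < n" "2 * k \<le> n" and l: "l \<in> even_partitions k"
  shows "(1 / 2) ^ k * n powr z l \<le> moment n z (power_sum_product n l)"
    and "moment n z (power_sum_product n l) \<le> (real k + 1) ^ k * n powr z l"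
proof -
  have s: "shape {..<n} (Poly_Mapping.lookup (0 :: nat \<Rightarrow>\<^sub>0 nat)) = {#}"
    by (rule shape_zero) simp
  have k: "size l \<le> k" by (rule size_even_partition_le[OF l])
  have "(1 / 2) ^ k * n powr z l \<le> (1 / 2) ^ size l * n powr z l"
    using k by (intro mult_right_mono power_decreasing) auto
  also have "\<dots> \<le> moment n z (power_sum_product n l)"
    using moment_power_sum_product_lower[OF n, of 0 l z] l by (simp add: s)
  finally show "(1 / 2) ^ k * n powr z l \<le> moment n z (power_sum_product n l)" .
  have "moment n z (power_sum_product n l) \<le> (real k + 1) ^ size l * n powr z l"
    using moment_power_sum_product_upper[OF z n(1), of 0 l] l by (simp add: s)
  also have "\<dots> \<le> (real k + 1) ^ k * n powr z l"
    using k by (intro mult_right_mono power_increasing) auto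
  finally show "moment n z (power_sum_product n l) \<le> (real k + 1) ^ k * n powr z l" .
qed

section \<open>Invariant vectors\<close>

text \<open>The exponents of two monomials of degree \<open>d\<close>: \<open>P\<close> lists the
  pairs at their common variables, \<open>nu\<close> and \<open>rho\<close> the even exponents at
  variables of only the first or only the second. The product then has shape
  \<open>image_mset (\<lambda>(a, b). a + b) P + nu + rho\<close>. Pairing the first monomial with a
  copy of itself moved away from the common variables gives \<open>nu + nu\<close>, not doubled
  parts.\<close>

definition admissible :: "nat \<Rightarrow> (nat \<times> nat) multiset \<Rightarrow> nat multiset \<Rightarrow> nat multiset \<Rightarrow> bool" where
  "admissible d P nu rho \<longleftrightarrow> (\<forall>(a, b)\<in>#P. 0 < a \<and> 0 < b \<and> even (a + b)) \<and>
     (\<forall>r\<in>#nu + rho. 0 < r \<and> even r) \<and>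
     sum_mset (image_mset fst P) + sum_mset nu = d \<and> sum_mset (image_mset snd P) + sum_mset rho = d"

text \<open>The constants serve the case of different supports: there the count of variables gains
  1, four values of \<open>z\<close> cost at most 4/8, and the remaining 1/2 has to cover
  \<open>2 * \<delta>\<close>.\<close>

locale gapped_exponent =
  fixes d :: nat and z :: "nat multiset \<Rightarrow> real" and \<delta> :: real
  assumes d: "1 \<le> d"
    and merge: "merge_monotone (2 * d) z"
    and small: "l \<in> even_partitions (2 * d) \<Longrightarrow> \<bar>z l\<bar> \<le> 1 / 8"
    and \<delta>: "0 < \<delta>" "\<delta> \<le> 1 / 4"
    and gap: "admissible d P nu rho \<Longrightarrow> (\<exists>(a, b)\<in>#P. a \<noteq> b) \<or> nu \<noteq> rho \<Longrightarrow>
      2 * z (image_mset (\<lambda>(a, b). a + b) P + nu + rho) + 2 * \<delta> \<le>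
        z (image_mset (\<lambda>(a, b). 2 * a) P + nu + nu) + z (image_mset (\<lambda>(a, b). 2 * b) P + rho + rho)"

text \<open>A parity class of monomials of degree \<open>d\<close>. The functional vanishes on
  products across two classes, so the Gram matrix splits along \<open>T\<close>. Plain functions let
  permutations of the variables act by composition.\<close>

definition exponents :: "nat \<Rightarrow> nat \<Rightarrow> nat set \<Rightarrow> (nat \<Rightarrow> nat) set" where
  "exponents n d T = {c. (\<forall>i. n \<le> i \<longrightarrow> c i = 0) \<and> sum c {..<n} = d \<and> (\<forall>i. odd (c i) \<longleftrightarrow> i \<in> T)}"

lemma exponents_le: "c \<in> exponents n d T \<Longrightarrow> c i \<le> d"
  using member_le_sum[of i "{..<n}" c] by (cases "i < n") (auto simp: exponents_def)

lemma finite_exponents: "finite (exponents n d T)"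
proof (rule finite_subset)
  show "exponents n d T \<subseteq> {c. \<forall>i. (i \<in> {..<n} \<longrightarrow> c i \<in> {..d}) \<and> (i \<notin> {..<n} \<longrightarrow> c i = 0)}"
    using exponents_le by (auto simp: exponents_def)
  show "finite {c :: nat \<Rightarrow> nat. \<forall>i. (i \<in> {..<n} \<longrightarrow> c i \<in> {..d}) \<and> (i \<notin> {..<n} \<longrightarrow> c i = 0)}"
    by (rule finite_set_of_finite_funs) auto
qed

text \<open>Writing the weight as a product over coordinates is what lets sums over exponent vectors
  factor.\<close>

lemma powr_minus_size_shape:
  assumes "finite S" "0 < n"
  shows "real n powr - real (size (shape S c)) = (\<Prod>i\<in>S. if c i = 0 then 1 else 1 / n)"
  using assms(1)
proof (induction S rule: finite_induct)
  case (insert i S)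
  have "- (1 + real (size (shape S c))) = - real (size (shape S c)) - 1" by simp
  then have "real n powr - (1 + real (size (shape S c))) = real n powr - real (size (shape S c)) / n"
    using assms(2) by (simp only: powr_diff) simp
  then show ?case using insert assms by (simp add: shape_insert)
qed (use assms in simp)

lemma shape_eq_image_support:
  "finite S \<Longrightarrow> shape S c = image_mset c (mset_set {i\<in>S. c i \<noteq> 0})"
  by (simp add: shape_def filter_mset_image_mset filter_mset_mset_set)

lemma ex_image_mset_eq:
  "finite S \<Longrightarrow> card S = size M \<Longrightarrow> \<exists>c. image_mset c (mset_set S) = M"
proof (induction S arbitrary: M rule: finite_induct)
  case (insert i S)
  then obtain a M' where M: "M = add_mset a M'"
    by (metis card_insert_disjoint multiset_cases size_empty old.nat.distinct(2))
  then obtain c where c: "image_mset c (mset_set S) = M'" using insert by fastforce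
  have "image_mset (c(i := a)) (mset_set S) = image_mset c (mset_set S)"
    using insert by (intro image_mset_cong) auto
  then have "image_mset (c(i := a)) (mset_set (insert i S)) = M" using insert by (simp add: M c)
  then show ?case by blast
qed simp

text \<open>A shape forgets the zeros, but their number is recovered from \<open>card S\<close>. So
  equal shapes mean equal multisets of values, which differ by a permutation.\<close>

lemma ex_permutation_of_shape_eq:
  assumes S: "finite S" and eq: "shape S b = shape S c"
  obtains p where "p permutes S" "\<And>i. i \<in> S \<Longrightarrow> b i = c (p i)"
proof -
  have split: "image_mset f (mset_set S) = shape S f + replicate_mset (card S - size (shape S f)) 0" for f
  proof -
    have "image_mset f (mset_set S) = shape S f + filter_mset (\<lambda>r. \<not> 0 < r) (image_mset f (mset_set S))"
      unfolding shape_def by (rule multiset_partition)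
    moreover have "filter_mset (\<lambda>r. \<not> 0 < r) (image_mset f (mset_set S)) =
        replicate_mset (size (filter_mset (\<lambda>r. \<not> 0 < r) (image_mset f (mset_set S)))) 0"
      using set_mset_subset_singletonD[of "filter_mset (\<lambda>r. \<not> 0 < r) (image_mset f (mset_set S))" 0] by auto
    ultimately have e: "image_mset f (mset_set S) = shape S f +
        replicate_mset (size (filter_mset (\<lambda>r. \<not> 0 < r) (image_mset f (mset_set S)))) 0" by simp
    from arg_cong[OF this, of size] have "size (filter_mset (\<lambda>r. \<not> 0 < r) (image_mset f (mset_set S))) =
        card S - size (shape S f)" by simp
    with e show ?thesis by simp
  qed
  have "image_mset b (mset_set S) = image_mset c (mset_set S)"
    by (rule trans[OF split trans[OF _ split[symmetric]]]) (simp only: eq)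
  then obtain p where "p permutes S" "\<forall>i\<in>S. b i = c (p i)"
    by (rule image_mset_eq_implies_permutes[OF S])
  then show thesis using that by simp
qed

lemma finite_bounded_multisets: "finite {nu :: nat multiset. sum_mset nu \<le> k \<and> (\<forall>r\<in>#nu. 0 < r)}"
proof (rule finite_subset)
  show "{nu. sum_mset nu \<le> k \<and> (\<forall>r\<in>#nu. 0 < r)} \<subseteq> mset ` {xs. set xs \<subseteq> {..k} \<and> length xs \<le> k}"
  proof
    fix l :: "nat multiset" assume l: "l \<in> {nu. sum_mset nu \<le> k \<and> (\<forall>r\<in>#nu. 0 < r)}"
    obtain xs where xs: "l = mset xs" by (metis ex_mset)
    have "length xs \<le> k"
      using size_le_sum_mset[of l] l xs by auto
    moreover have "set xs \<subseteq> {..k}"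
      using l xs member_le_sum_list by (fastforce simp: sum_mset_sum_list)
    ultimately show "l \<in> mset ` {xs. set xs \<subseteq> {..k} \<and> length xs \<le> k}"
      using xs by blast
  qed
qed (simp add: finite_lists_length_le)

text \<open>\<open>W\<close> is the support of the monomial that the averaging fixes. It contains
  \<open>T\<close>, so all exponents outside \<open>W\<close> are even. The bound on
  \<open>n\<close> leaves at least \<open>n / 2\<close> and at least \<open>2 * d\<close> variables
  outside \<open>W\<close>.\<close>

locale marked_exponents = gapped_exponent +
  fixes n :: nat and W T :: "nat set"
  assumes W: "W \<subseteq> {..<n}" "card W \<le> d" and T: "T \<subseteq> W" and n: "4 * d \<le> n"
begin

section \<open>Orders of magnitude of the blocks of the Gram matrix\<close>

abbreviation "Out \<equiv> {..<n} - W"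
abbreviation "E \<equiv> exponents n d T"

definition kernel :: "(nat \<Rightarrow> nat) \<Rightarrow> (nat \<Rightarrow> nat) \<Rightarrow> real" where
  "kernel b c = weight n z (shape {..<n} (\<lambda>i. b i + c i))"

text \<open>The orbit invariant for permutations of \<open>Out\<close>: by
  \<open>ex_permutation_of_shape_eq\<close>, vectors of \<open>E\<close> with equal keys differ by
  such a permutation.\<close>

definition key :: "(nat \<Rightarrow> nat) \<Rightarrow> (nat \<Rightarrow> nat) \<times> nat multiset" where
  "key b = (restrict b W, shape Out b)"

text \<open>The shape of the product when the supports outside \<open>W\<close> are disjoint, the
  position that determines the order of a diagonal block.\<close>

definition joint :: "(nat \<Rightarrow> nat) \<Rightarrow> (nat \<Rightarrow> nat) \<Rightarrow> nat multiset" where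
  "joint b c = shape W (\<lambda>i. b i + c i) + shape Out b + shape Out c"

text \<open>The exponent of \<open>n\<close> in a block sum. Only variables in \<open>W\<close> are
  subtracted: the others have about \<open>n\<close> possible positions each, which balances their
  factor 1/n.\<close>

definition order_exponent :: "(nat \<Rightarrow> nat) \<Rightarrow> (nat \<Rightarrow> nat) \<Rightarrow> real" where
  "order_exponent b c = z (joint b c) - size (shape W (\<lambda>i. b i + c i))"

lemma n_pos: "0 < n" using d n by linarith

lemma fin [simp]: "finite W" "finite Out" using W finite_subset by auto

lemma even_Out: "b \<in> E \<Longrightarrow> i \<in> Out \<Longrightarrow> even (b i)"
  using T by (auto simp: exponents_def)

lemma even_exponent_add: "b \<in> E \<Longrightarrow> c \<in> E \<Longrightarrow> even (b i + c i)"
  by (auto simp: exponents_def)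

lemma sum_split: "b \<in> E \<Longrightarrow> sum b W + sum b Out = d"
  using sum.subset_diff[of W "{..<n}" b] W by (simp add: exponents_def)

lemma joint_even_partition: "b \<in> E \<Longrightarrow> c \<in> E \<Longrightarrow> joint b c \<in> even_partitions (2 * d)"
  using even_Out[of b] even_Out[of c] even_exponent_add[of b c] sum_split[of b] sum_split[of c]
  by (auto simp: joint_def even_partitions_def in_shape_iff sum_mset_shape sum.distrib)

lemma shape_split: "shape {..<n} b = shape W b + shape Out b"
  using shape_union[of W Out b] W by (simp add: Un_absorb1)

lemma kernel_eq:
  assumes "b \<in> E" "c \<in> E"
  shows "kernel b c = n powr (z (shape W (\<lambda>i. b i + c i) + shape Out (\<lambda>i. b i + c i))
    - size (shape W (\<lambda>i. b i + c i)) - size (shape Out (\<lambda>i. b i + c i)))"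
  using even_exponent_add[OF assms]
  by (auto simp: kernel_def weight_def in_shape_iff shape_split diff_diff_eq)

lemma key_eqD:
  assumes "key b = key b'" "key c = key c'"
  shows "shape W (\<lambda>i. b i + c i) = shape W (\<lambda>i. b' i + c' i)" "joint b c = joint b' c'"
proof -
  have "b i = b' i" "c i = c' i" if "i \<in> W" for i
    using assms that unfolding key_def by (metis (mono_tags) Pair_inject restrict_apply')+
  then show "shape W (\<lambda>i. b i + c i) = shape W (\<lambda>i. b' i + c' i)"
    by (intro shape_cong) simp
  then show "joint b c = joint b' c'" using assms by (simp add: joint_def key_def)
qed

text \<open>Overlaps outside \<open>W\<close> are merges, so they do not raise \<open>z\<close>
  above its value at \<open>joint b c\<close>. What depends on the positions is then a product over
  \<open>Out\<close>.\<close>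

lemma kernel_le:
  assumes "b \<in> E" "c \<in> E" "key b = key b0" "key c = key c0"
  shows "kernel b c \<le> n powr order_exponent b0 c0 * (\<Prod>i\<in>Out. if (b i, c i) = (0, 0) then 1 else 1 / n)"
proof -
  let ?s = "size (shape W (\<lambda>i. b i + c i))" and ?o = "shape Out (\<lambda>i. b i + c i)"
  have "z (shape W (\<lambda>i. b i + c i) + ?o) \<le> z (joint b c)"
    unfolding joint_def
    using shape_add_le[OF merge fin(2), of "shape W (\<lambda>i. b i + c i)" b c] joint_even_partition[OF assms(1,2)]
    by (simp add: joint_def)
  then have "kernel b c \<le> n powr (z (joint b c) - ?s - size ?o)"
    unfolding kernel_eq[OF assms(1,2)] using n_pos by (intro powr_mono) auto
  also have "\<dots> = n powr order_exponent b0 c0 * n powr - real (size ?o)"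
    using key_eqD[OF assms(3,4)] by (simp add: order_exponent_def powr_add[symmetric])
  also have "n powr - real (size ?o) = (\<Prod>i\<in>Out. if b i + c i = 0 then 1 else 1 / n)"
    by (rule powr_minus_size_shape) (auto simp: n_pos)
  finally show ?thesis by simp
qed

text \<open>Let every coordinate outside \<open>W\<close> range freely over pairs of exponents up to
  \<open>d\<close>. The sum then factors into at most \<open>n\<close> factors, each at most
  \<open>1 + (d + 1)\<^sup>2 / n\<close>, and their product stays below an exponential independent
  of \<open>n\<close>.\<close>

lemma block_sum_upper:
  "(\<Sum>b\<in>{b\<in>E. key b = key b0}. \<Sum>c\<in>{c\<in>E. key c = key c0}. kernel b c) \<le>
    exp ((d + 1)\<^sup>2) * n powr order_exponent b0 c0"
proof -
  let ?B = "{b\<in>E. key b = key b0}" and ?C = "{c\<in>E. key c = key c0}"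
  define g :: "nat \<times> nat \<Rightarrow> real" where "g p = (if p = (0, 0) then 1 else 1 / n)" for p
  \<comment> \<open>A pair with prescribed keys is determined by its values on \<open>Out\<close>:
    the keys fix those on \<open>W\<close>, and exponents vanish from \<open>n\<close> on.\<close>
  define \<iota> where "\<iota> = (\<lambda>(b :: nat \<Rightarrow> nat, c :: nat \<Rightarrow> nat). \<lambda>i\<in>Out. (b i, c i))"
  have g0: "0 \<le> g p" for p by (simp add: g_def)
  have recover: "b = b'" if "b \<in> E" "b' \<in> E" "key b = key b'" "\<And>i. i \<in> Out \<Longrightarrow> b i = b' i" for b b'
  proof
    fix i
    consider "i \<in> W" | "i \<in> Out" | "n \<le> i" by fastforce
    then show "b i = b' i"
    proof cases
      case 1
      then show ?thesis using that(3) unfolding key_def by (metis (mono_tags) Pair_inject restrict_apply')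
    qed (use that in \<open>auto simp: exponents_def\<close>)
  qed
  have inj: "inj_on \<iota> (?B \<times> ?C)"
  proof (rule inj_onI, clarify, rule conjI)
    fix b c b' c' assume h: "b \<in> E" "key b = key b0" "c \<in> E" "key c = key c0"
      "b' \<in> E" "key b' = key b0" "c' \<in> E" "key c' = key c0" "\<iota> (b, c) = \<iota> (b', c')"
    have "(b i, c i) = (b' i, c' i)" if "i \<in> Out" for i
      using fun_cong[OF h(9), of i] that by (simp add: \<iota>_def)
    then have eq: "b i = b' i" "c i = c' i" if "i \<in> Out" for i using that by auto
    show "b = b'" by (rule recover) (use h eq in auto)
    show "c = c'" by (rule recover) (use h eq in auto)
  qed
  have "(\<Sum>b\<in>?B. \<Sum>c\<in>?C. kernel b c) \<le> (\<Sum>b\<in>?B. \<Sum>c\<in>?C. n powr order_exponent b0 c0 * (\<Prod>i\<in>Out. g (b i, c i)))"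
    unfolding g_def by (intro sum_mono kernel_le) auto
  also have "\<dots> = n powr order_exponent b0 c0 * (\<Sum>b\<in>?B. \<Sum>c\<in>?C. \<Prod>i\<in>Out. g (b i, c i))"
    by (simp add: sum_distrib_left)
  finally have le: "(\<Sum>b\<in>?B. \<Sum>c\<in>?C. kernel b c) \<le>
      n powr order_exponent b0 c0 * (\<Sum>b\<in>?B. \<Sum>c\<in>?C. \<Prod>i\<in>Out. g (b i, c i))" .
  have "(\<Sum>b\<in>?B. \<Sum>c\<in>?C. \<Prod>i\<in>Out. g (b i, c i)) = (\<Sum>x\<in>?B \<times> ?C. \<Prod>i\<in>Out. g (\<iota> x i))"
    by (auto simp: sum.cartesian_product \<iota>_def intro!: sum.cong prod.cong)
  also have "\<dots> = (\<Sum>h\<in>\<iota> ` (?B \<times> ?C). \<Prod>i\<in>Out. g (h i))"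
    by (simp add: sum.reindex[OF inj])
  also have "\<dots> \<le> (\<Sum>h\<in>(\<Pi>\<^sub>E i\<in>Out. {..d} \<times> {..d}). \<Prod>i\<in>Out. g (h i))"
    by (intro sum_mono2 prod_nonneg finite_PiE g0 ballI)
       (auto simp: \<iota>_def exponents_le intro!: PiE_I split: if_splits)
  also have "\<dots> = (\<Prod>i\<in>Out. \<Sum>p\<in>{..d} \<times> {..d}. g p)"
    by (rule prod_sum_PiE[symmetric]) auto
  also have "\<dots> \<le> (1 + (d + 1)\<^sup>2 / n) ^ card Out"
  proof -
    have "(\<Sum>p\<in>{..d} \<times> {..d}. g p) \<le> (\<Sum>p\<in>{..d} \<times> {..d}. (if p = (0, 0) then 1 else 0) + 1 / n)"
      by (intro sum_mono) (auto simp: g_def)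
    also have "\<dots> = 1 + (d + 1)\<^sup>2 / n"
      by (subst sum.distrib, subst sum.delta) (auto simp: power2_eq_square)
    finally show ?thesis by (simp add: power_mono sum_nonneg g0)
  qed
  also have "\<dots> \<le> (1 + (d + 1)\<^sup>2 / n) ^ n"
    using card_mono[of "{..<n}" Out] by (intro power_increasing) auto
  also have "\<dots> \<le> exp ((d + 1)\<^sup>2)"
    by (rule exp_ge_one_plus_x_over_n_power_n) (use n_pos in \<open>auto intro: order_trans[of _ 0]\<close>)
  finally have "n powr order_exponent b0 c0 * (\<Sum>b\<in>?B. \<Sum>c\<in>?C. \<Prod>i\<in>Out. g (b i, c i)) \<le>
      n powr order_exponent b0 c0 * exp ((d + 1)\<^sup>2)"
    by (rule mult_left_mono) simp
  with le show ?thesis by (simp only: mult.commute)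
qed

lemma size_Out_le:
  assumes "b \<in> E" shows "size (shape Out b) \<le> d"
proof -
  have "size (shape Out b) \<le> sum_mset (shape Out b)"
    by (rule size_le_sum_mset) (simp add: in_shape_iff)
  also have "\<dots> \<le> d" using sum_split[OF assms] by (simp add: sum_mset_shape)
  finally show ?thesis .
qed

text \<open>Cut \<open>D\<close> into halves and place the outside parts of \<open>b0\<close> on
  each. No merging occurs, so the kernel takes the value predicted by \<open>joint\<close>; and
  \<open>D\<close> can be read off from the pair.\<close>

lemma ex_disjoint_pair:
  assumes b0: "b0 \<in> E" and D: "D \<subseteq> Out" "card D = 2 * size (shape Out b0)"
  obtains b c where "b \<in> E" "c \<in> E" "key b = key b0" "key c = key b0"
    "D = {i\<in>Out. b i + c i \<noteq> 0}" "kernel b c = n powr (order_exponent b0 b0 - card D)"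
proof -
  have finD: "finite D" by (rule finite_subset[OF D(1) fin(2)])
  have "size (shape Out b0) \<le> card D" using D(2) by simp
  then obtain D1 where D1: "D1 \<subseteq> D" "card D1 = size (shape Out b0)"
    by (rule obtain_subset_with_card_n)
  have finD1: "finite D1" by (rule finite_subset[OF D1(1) finD])
  have extend: "\<exists>b. b \<in> E \<and> key b = key b0 \<and> {i\<in>Out. b i \<noteq> 0} = D'"
    if D': "D' \<subseteq> D" "card D' = size (shape Out b0)" for D'
  proof -
    have finD': "finite D'" by (rule finite_subset[OF D'(1) finD])
    obtain f where f: "image_mset f (mset_set D') = shape Out b0"
      using ex_image_mset_eq[OF finD' D'(2)] by blast
    have f_in: "f i \<in># shape Out b0" if "i \<in> D'" for i
      using that finD' by (simp flip: f)
    then have f_pos: "0 < f i" "even (f i)" if "i \<in> D'" for i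
      using that even_Out[OF b0] by (fastforce simp: in_shape_iff)+
    define b where "b i = (if i \<in> W then b0 i else if i \<in> D' then f i else 0)" for i
    have supp: "{i\<in>Out. b i \<noteq> 0} = D'"
      using f_pos D' D W by (auto simp: b_def)
    have "shape Out b = image_mset b (mset_set D')"
      by (simp only: shape_eq_image_support[OF fin(2)] supp)
    also have "\<dots> = image_mset f (mset_set D')"
      using D' D by (intro image_mset_cong) (auto simp: b_def finD')
    finally have sh: "shape Out b = shape Out b0" by (simp add: f)
    then have so: "sum b Out = sum b0 Out" by (metis sum_mset_shape fin(2))
    have sw: "sum b W = sum b0 W" by (simp add: b_def)
    have "sum b {..<n} = d"
      using sum.subset_diff[of W "{..<n}" b] W so sw sum_split[OF b0] by simp
    moreover have "odd (b i) \<longleftrightarrow> i \<in> T" for i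
      using b0 T f_pos[of i] by (auto simp: b_def exponents_def)
    moreover have "b i = 0" if "n \<le> i" for i
      using that W D' D by (auto simp: b_def)
    ultimately have "b \<in> E" by (simp add: exponents_def)
    moreover have "key b = key b0" by (auto simp: key_def sh b_def)
    ultimately show ?thesis using supp by blast
  qed
  obtain b where b: "b \<in> E" "key b = key b0" "{i\<in>Out. b i \<noteq> 0} = D1"
    using extend[OF D1] by blast
  have "D - D1 \<subseteq> D" "card (D - D1) = size (shape Out b0)"
    using D D1 finD by (auto simp: card_Diff_subset finD1)
  then obtain c where c: "c \<in> E" "key c = key b0" "{i\<in>Out. c i \<noteq> 0} = D - D1"
    using extend by blast
  have "{i\<in>Out. b i + c i \<noteq> 0} = {i\<in>Out. b i \<noteq> 0} \<union> {i\<in>Out. c i \<noteq> 0}" by auto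
  then have D_eq: "D = {i\<in>Out. b i + c i \<noteq> 0}" using b(3) c(3) D1 by auto
  have "shape Out (\<lambda>i. b i + c i) = image_mset (\<lambda>i. b i + c i) (mset_set (D1 \<union> (D - D1)))"
    using D1(1) by (simp only: shape_eq_image_support[OF fin(2)] D_eq[symmetric] Un_Diff_cancel Un_absorb1)
  also have "\<dots> = image_mset (\<lambda>i. b i + c i) (mset_set D1) + image_mset (\<lambda>i. b i + c i) (mset_set (D - D1))"
    using finD finD1 by (subst mset_set_Union) auto
  also have "image_mset (\<lambda>i. b i + c i) (mset_set D1) = image_mset b (mset_set D1)"
  proof (rule image_mset_cong)
    fix i assume "i \<in># mset_set D1"
    then have "i \<in> D1" using finD1 by auto
    then have "i \<in> Out" "i \<notin> D - D1" using D1 D by auto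
    then have "i \<in> Out" "i \<notin> {i\<in>Out. c i \<noteq> 0}" unfolding c(3) by simp_all
    then show "b i + c i = b i" by simp
  qed
  also have "image_mset (\<lambda>i. b i + c i) (mset_set (D - D1)) = image_mset c (mset_set (D - D1))"
  proof (rule image_mset_cong)
    fix i assume "i \<in># mset_set (D - D1)"
    then have "i \<in> D - D1" using finD by auto
    then have "i \<in> Out" "i \<notin> D1" using D1 D by auto
    then have "i \<in> Out" "i \<notin> {i\<in>Out. b i \<noteq> 0}" unfolding b(3) by simp_all
    then show "b i + c i = c i" by simp
  qed
  also have "image_mset b (mset_set D1) = shape Out b0"
    using b(2) by (simp only: b(3)[symmetric] shape_eq_image_support[OF fin(2), symmetric] key_def prod.inject)
  also have "image_mset c (mset_set (D - D1)) = shape Out b0"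
    using c(2) by (simp only: c(3)[symmetric] shape_eq_image_support[OF fin(2), symmetric] key_def prod.inject)
  finally have out: "shape Out (\<lambda>i. b i + c i) = shape Out b0 + shape Out b0" .
  have "kernel b c = n powr (order_exponent b0 b0 - card D)"
    unfolding kernel_eq[OF b(1) c(1)] out key_eqD(1)[OF b(2) c(2)] D(2)
    by (simp add: order_exponent_def joint_def add.assoc)
  with b c D_eq that show thesis by blast
qed

text \<open>With \<open>L\<close> parts outside \<open>W\<close>, each subset of \<open>Out\<close>
  of size \<open>2 * L\<close> supplies a different disjoint pair. The binomial coefficient is at
  least \<open>(card Out / (2 * L)) ^ (2 * L)\<close>, and \<open>card Out\<close> \<ge>
  \<open>n / 2\<close> makes this at least \<open>(n / (4 * d)) ^ (2 * L)\<close> for positive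
  \<open>L\<close>, which cancels the power of \<open>n\<close> lost in the kernel.\<close>

lemma block_sum_lower:
  assumes b0: "b0 \<in> E"
  shows "(1 / (4 * d)) ^ (2 * d) * n powr order_exponent b0 b0 \<le>
    (\<Sum>b\<in>{b\<in>E. key b = key b0}. \<Sum>c\<in>{c\<in>E. key c = key b0}. kernel b c)"
proof -
  let ?B = "{b\<in>E. key b = key b0}"
  define L where "L = size (shape Out b0)"
  have L: "L \<le> d" unfolding L_def by (rule size_Out_le[OF b0])
  define S where "S = {D. D \<subseteq> Out \<and> card D = 2 * L}"
  have "\<exists>x. \<forall>D\<in>S. x D \<in> ?B \<times> ?B \<and> D = {i\<in>Out. fst (x D) i + snd (x D) i \<noteq> 0} \<and>
      kernel (fst (x D)) (snd (x D)) = n powr (order_exponent b0 b0 - (2 * L))"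
  proof (rule bchoice, rule ballI)
    fix D assume "D \<in> S"
    then have D: "D \<subseteq> Out" "card D = 2 * size (shape Out b0)" by (auto simp: S_def L_def)
    obtain b c where "b \<in> E" "c \<in> E" "key b = key b0" "key c = key b0"
      "D = {i\<in>Out. b i + c i \<noteq> 0}" "kernel b c = n powr (order_exponent b0 b0 - card D)"
      by (rule ex_disjoint_pair[OF b0 D])
    then show "\<exists>x. x \<in> ?B \<times> ?B \<and> D = {i\<in>Out. fst x i + snd x i \<noteq> 0} \<and>
        kernel (fst x) (snd x) = n powr (order_exponent b0 b0 - (2 * L))"
      using D by (intro exI[of _ "(b, c)"]) (simp add: L_def)
  qed
  then obtain x where x0: "\<forall>D\<in>S. x D \<in> ?B \<times> ?B \<and> D = {i\<in>Out. fst (x D) i + snd (x D) i \<noteq> 0} \<and>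
      kernel (fst (x D)) (snd (x D)) = n powr (order_exponent b0 b0 - (2 * L))" ..
  note x = x0[THEN bspec, THEN conjunct1] x0[THEN bspec, THEN conjunct2, THEN conjunct1]
    x0[THEN bspec, THEN conjunct2, THEN conjunct2]
  have inj: "inj_on x S"
  proof (rule inj_onI)
    fix D D' assume "D \<in> S" "D' \<in> S" "x D = x D'"
    then show "D = D'" using x(2)[of D] x(2)[of D'] by simp
  qed
  have Out: "real n / 2 \<le> card Out" "2 * L \<le> card Out"
    using W n L by (auto simp: card_Diff_subset)
  have "(1 / (4 * d)) ^ (2 * d) * n powr order_exponent b0 b0 \<le> (1 / (4 * d)) ^ (2 * L) * n powr order_exponent b0 b0"
    using L d by (intro mult_right_mono power_decreasing) auto
  also have "\<dots> \<le> (card Out choose (2 * L)) * n powr (order_exponent b0 b0 - (2 * L))"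
  proof (cases "L = 0")
    case False
    have "(1 / (4 * d)) ^ (2 * L) \<le> (real (card Out) / (2 * L) / n) ^ (2 * L)"
    proof (rule power_mono)
      have "1 / (4 * real d) \<le> 1 / (4 * L)" using L False by (intro divide_left_mono) auto
      also have "\<dots> \<le> real (card Out) / (2 * L) / n"
        using Out(1) n_pos False by (simp add: field_simps)
      finally show "1 / real (4 * d) \<le> real (card Out) / real (2 * L) / n" by simp
    qed simp
    also have "\<dots> = (real (card Out) / (2 * L)) ^ (2 * L) / n ^ (2 * L)"
      by (simp only: power_divide of_nat_power)
    also have "\<dots> \<le> (card Out choose (2 * L)) / n ^ (2 * L)"
      using binomial_ge_n_over_k_pow_k[OF Out(2), where 'a = real] by (intro divide_right_mono) auto
    finally have "(1 / (4 * d)) ^ (2 * L) \<le> (card Out choose (2 * L)) / n ^ (2 * L)" .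
    from mult_right_mono[OF this, of "n powr order_exponent b0 b0"] show ?thesis
      using n_pos powr_realpow[of "real n" "2 * L"] by (simp add: powr_diff)
  qed simp
  also have "\<dots> = (\<Sum>D\<in>S. kernel (fst (x D)) (snd (x D)))"
    using n_subsets[of Out "2 * L"] by (simp add: x(3) S_def)
  also have "\<dots> = (\<Sum>y\<in>x ` S. kernel (fst y) (snd y))"
    by (simp add: sum.reindex[OF inj])
  also have "\<dots> \<le> (\<Sum>y\<in>?B \<times> ?B. kernel (fst y) (snd y))"
  proof (rule sum_mono2)
    show "x ` S \<subseteq> ?B \<times> ?B" by (rule image_subsetI) (rule x(1))
  qed (use finite_exponents[of n d T] in \<open>auto simp: kernel_def\<close>)
  also have "\<dots> = (\<Sum>b\<in>?B. \<Sum>c\<in>?B. kernel b c)"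
    by (simp add: sum.cartesian_product case_prod_unfold)
  finally show ?thesis .
qed

text \<open>
  If \<open>b\<close> and \<open>c\<close> have different supports \<open>U\<close>, \<open>V\<close> in \<open>W\<close>, then \<open>card (U \<union> V)\<close> exceeds the mean of
  \<open>card U\<close> and \<open>card V\<close> by at least \<open>1 / 2\<close>, which outweighs the small values of \<open>z\<close>.
\<close>

lemma order_exponent_gap:
  assumes b: "b \<in> E" and c: "c \<in> E" and "key b \<noteq> key c"
  shows "2 * order_exponent b c + 2 * \<delta> \<le> order_exponent b b + order_exponent c c"
proof -
  let ?U = "{i\<in>W. b i \<noteq> 0}" and ?V = "{i\<in>W. c i \<noteq> 0}"
  have "{i\<in>W. b i + c i \<noteq> 0} = ?U \<union> ?V" by auto
  then have sizes: "size (shape W (\<lambda>i. b i + c i)) = card (?U \<union> ?V)"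
      "size (shape W (\<lambda>i. b i + b i)) = card ?U" "size (shape W (\<lambda>i. c i + c i)) = card ?V"
    by (simp_all add: size_shape)
  show ?thesis
  proof (cases "?U = ?V")
    case False
    have "?U \<subset> ?U \<union> ?V \<or> ?V \<subset> ?U \<union> ?V" using False by blast
    then have "card ?U < card (?U \<union> ?V) \<or> card ?V < card (?U \<union> ?V)"
      by (auto intro!: psubset_card_mono)
    moreover have "card ?U \<le> card (?U \<union> ?V)" "card ?V \<le> card (?U \<union> ?V)"
      by (auto intro!: card_mono)
    ultimately have "card ?U + card ?V + 1 \<le> 2 * card (?U \<union> ?V)" by linarith
    then have "real (card ?U) + real (card ?V) + 1 \<le> 2 * real (card (?U \<union> ?V))" by linarith
    moreover have "z (joint b c) \<le> 1 / 8" "- (1 / 8) \<le> z (joint b b)" "- (1 / 8) \<le> z (joint c c)"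
      using small[OF joint_even_partition[OF b c]] small[OF joint_even_partition[OF b b]]
        small[OF joint_even_partition[OF c c]] by linarith+
    ultimately show ?thesis
      using \<delta> unfolding order_exponent_def sizes right_diff_distrib by linarith
  next
    case True
    \<comment> \<open>With equal supports in \<open>W\<close> the counts of variables cancel, and
      the exponents on \<open>W\<close> with the two outside shapes are exactly the data of an
      admissible triple.\<close>
    define P where "P = image_mset (\<lambda>i. (b i, c i)) (mset_set ?U)"
    have supp: "{i\<in>W. b i + c i \<noteq> 0} = ?U" "{i\<in>W. b i + b i \<noteq> 0} = ?U" "{i\<in>W. c i + c i \<noteq> 0} = ?U"
      using True by auto
    have shapes: "image_mset (\<lambda>(a, b). a + b) P = shape W (\<lambda>i. b i + c i)"
        "image_mset (\<lambda>(a, b). 2 * a) P = shape W (\<lambda>i. b i + b i)"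
        "image_mset (\<lambda>(a, b). 2 * b) P = shape W (\<lambda>i. c i + c i)"
      by (simp_all only: shape_eq_image_support[OF fin(1)] supp)
         (simp_all add: P_def image_mset.compositionality comp_def mult_2)
    have "sum_mset (image_mset fst P) = sum b W" "sum_mset (image_mset snd P) = sum c W"
      using True by (simp_all add: P_def image_mset.compositionality comp_def
          sum_mset_shape[OF fin(1), symmetric] shape_eq_image_support[OF fin(1)])
    moreover have "\<forall>(a, b)\<in>#P. 0 < a \<and> 0 < b \<and> even (a + b)"
      using True even_exponent_add[OF b c] by (auto simp: P_def)
    ultimately have "admissible d P (shape Out b) (shape Out c)"
      using even_Out[OF b] even_Out[OF c] sum_split[OF b] sum_split[OF c]
      by (auto simp: admissible_def in_shape_iff sum_mset_shape)
    moreover have "(\<exists>(a, b)\<in>#P. a \<noteq> b) \<or> shape Out b \<noteq> shape Out c"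
    proof (rule ccontr)
      assume not: "\<not> ?thesis"
      have "b i = c i" if "i \<in> W" for i
      proof (cases "i \<in> ?U")
        case True
        then show ?thesis using not by (auto simp: P_def)
      next
        case False
        then have "i \<notin> ?V" using \<open>?U = ?V\<close> by (simp only: not_False_eq_True)
        with False that show ?thesis by simp
      qed
      then have "restrict b W = restrict c W" by (intro restrict_ext)
      then show False using not assms(3) by (simp add: key_def)
    qed
    ultimately have "2 * z (joint b c) + 2 * \<delta> \<le> z (joint b b) + z (joint c c)"
      using gap by (simp add: joint_def shapes[symmetric])
    then show ?thesis using True unfolding order_exponent_def sizes by simp
  qed
qed

text \<open>The number of blocks is bounded independently of \<open>n\<close>, as \<open>W\<close>
  has at most \<open>d\<close> elements and the outside shapes have sum at most
  \<open>d\<close>.\<close>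

lemma card_keys_le:
  "card (key ` E) \<le> (d + 1) ^ d * card {nu :: nat multiset. sum_mset nu \<le> d \<and> (\<forall>r\<in>#nu. 0 < r)}"
proof -
  let ?N = "{nu :: nat multiset. sum_mset nu \<le> d \<and> (\<forall>r\<in>#nu. 0 < r)}"
  have "key ` E \<subseteq> (\<Pi>\<^sub>E i\<in>W. {..d}) \<times> ?N"
  proof (rule image_subsetI)
    fix b assume b: "b \<in> E"
    have "restrict b W \<in> (\<Pi>\<^sub>E i\<in>W. {..d})" using exponents_le[OF b] by auto
    moreover have "sum_mset (shape Out b) \<le> d" using sum_split[OF b] by (simp add: sum_mset_shape)
    moreover have "\<forall>r\<in>#shape Out b. 0 < r" by (simp add: in_shape_iff)
    ultimately show "key b \<in> (\<Pi>\<^sub>E i\<in>W. {..d}) \<times> ?N" by (simp add: key_def)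
  qed
  then have "card (key ` E) \<le> card ((\<Pi>\<^sub>E i\<in>W. {..d}) \<times> ?N)"
    by (intro card_mono finite_cartesian_product finite_PiE finite_bounded_multisets) auto
  also have "\<dots> = (d + 1) ^ card W * card ?N"
    by (simp add: card_cartesian_product card_PiE)
  also have "\<dots> \<le> (d + 1) ^ d * card ?N"
    using W by (intro mult_right_mono power_increasing) auto
  finally show ?thesis .
qed

text \<open>By the gap, off-diagonal blocks lose a factor \<open>n powr \<delta>\<close> against the
  geometric mean of the diagonal ones. \<open>large\<close> says that this outweighs the number of
  blocks and the constants of the two block bounds.\<close>

lemma invariant_form_nonneg:
  assumes large: "real ((d + 1) ^ d * card {nu :: nat multiset. sum_mset nu \<le> d \<and> (\<forall>r\<in>#nu. 0 < r)})
      * exp ((d + 1)\<^sup>2) \<le> (1 / (4 * d)) ^ (2 * d) * n powr \<delta>"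
    and inv: "\<And>b c. b \<in> E \<Longrightarrow> c \<in> E \<Longrightarrow> key b = key c \<Longrightarrow> w b = w c"
  shows "0 \<le> (\<Sum>b\<in>E. \<Sum>c\<in>E. w b * w c * kernel b c)"
proof -
  define k where "k = real ((d + 1) ^ d * card {nu :: nat multiset. sum_mset nu \<le> d \<and> (\<forall>r\<in>#nu. 0 < r)})"
  define C where "C = exp (real ((d + 1)\<^sup>2))"
  define a :: real where "a = (1 / (4 * d)) ^ (2 * d)"
  have k0: "0 \<le> k" by (simp add: k_def)
  define H where "H r s = (\<Sum>b\<in>{b\<in>E. key b = r}. \<Sum>c\<in>{c\<in>E. key c = s}. kernel b c)" for r s
  define w' where "w' r = w (SOME b. b \<in> E \<and> key b = r)" for r
  have w': "w b = w' (key b)" if "b \<in> E" for b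
  proof -
    have "(SOME c. c \<in> E \<and> key c = key b) \<in> E \<and> key (SOME c. c \<in> E \<and> key c = key b) = key b"
      using that by (intro someI[of "\<lambda>c. c \<in> E \<and> key c = key b"]) auto
    then show ?thesis unfolding w'_def using inv that by metis
  qed
  have H0: "0 \<le> H r s" for r s unfolding H_def kernel_def by (intro sum_nonneg) auto
  have "(\<Sum>b\<in>E. \<Sum>c\<in>E. w b * w c * kernel b c) = (\<Sum>b\<in>E. \<Sum>c\<in>E. w' (key b) * w' (key c) * kernel b c)"
    by (intro sum.cong refl) (simp add: w')
  also have "\<dots> = (\<Sum>r\<in>key ` E. \<Sum>s\<in>key ` E. w' r * w' s * H r s)"
    unfolding H_def by (rule sum_over_pairs_by_key[OF finite_exponents])
  also have "0 \<le> \<dots>"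
  proof (rule diagonally_dominant_nonneg)
    show "finite (key ` E)" using finite_exponents by simp
    show "real (card (key ` E)) \<le> k" unfolding k_def using card_keys_le by (simp only: of_nat_le_iff)
    show "0 \<le> H r r" for r by (rule H0)
    fix r s assume "r \<in> key ` E" "s \<in> key ` E" and rs: "r \<noteq> s"
    then obtain b c where b: "b \<in> E" "r = key b" and c: "c \<in> E" "s = key c" by blast
    have "k * H r s \<le> k * (C * n powr order_exponent b c)"
      unfolding H_def b(2) c(2) C_def by (intro mult_left_mono block_sum_upper k0)
    also have "\<dots> = k * C * n powr order_exponent b c" by simp
    also have "\<dots> \<le> a * n powr \<delta> * n powr order_exponent b c"
      using large unfolding k_def C_def a_def by (intro mult_right_mono) auto
    also have "\<dots> = a * n powr (order_exponent b c + \<delta>)" by (simp add: powr_add)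
    also have "\<dots> \<le> a * n powr (order_exponent b b / 2 + order_exponent c c / 2)"
      using order_exponent_gap[OF b(1) c(1)] rs b c n_pos
      by (intro mult_left_mono powr_mono) (auto simp: a_def)
    also have "\<dots> = sqrt (a * n powr order_exponent b b) * sqrt (a * n powr order_exponent c c)"
      using n_pos by (simp add: real_sqrt_mult powr_add powr_half_sqrt_powr[symmetric] a_def)
    also have "\<dots> \<le> sqrt (H r r) * sqrt (H s s)"
    proof -
      have "a * n powr order_exponent b b \<le> H r r" "a * n powr order_exponent c c \<le> H s s"
        unfolding H_def b(2) c(2) a_def by (rule block_sum_lower[OF b(1)], rule block_sum_lower[OF c(1)])
      then show ?thesis by (intro mult_mono real_sqrt_le_mono) (auto simp: H0 a_def)
    qed
    finally show "k * \<bar>H r s\<bar> \<le> sqrt (H r r) * sqrt (H s s)" using H0[of r s] by simp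
  qed
  finally show ?thesis .
qed

end

section \<open>Nonnegativity on squares\<close>

lemma shape_comp_permutes:
  assumes "p permutes S"
  shows "shape S (\<lambda>i. c (p i)) = shape S c"
proof -
  have "image_mset (\<lambda>i. c (p i)) (mset_set S) = image_mset c (image_mset p (mset_set S))"
    by (simp add: image_mset.compositionality comp_def)
  also have "image_mset p (mset_set S) = mset_set S"
    using assms by (simp add: image_mset_mset_set permutes_inj_on permutes_image)
  finally show ?thesis by (simp add: shape_def)
qed

lemma comp_permutes_in_exponents:
  assumes b: "b \<in> exponents n d T" and p: "p permutes S" and S: "S \<subseteq> {..<n}" "S \<inter> T = {}"
  shows "b \<circ> p \<in> exponents n d T"
proof -
  have pn: "p permutes {..<n}" by (rule permutes_subset[OF p S(1)])
  have "sum (b \<circ> p) {..<n} = sum b {..<n}" by (rule sum.permute[OF pn, symmetric])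
  moreover have "p i \<in> T \<longleftrightarrow> i \<in> T" for i
    using p S(2) permutes_in_image[OF p, of i] permutes_not_in[OF p, of i] by (cases "i \<in> S") auto
  moreover have "b (p i) = 0" if "n \<le> i" for i
    using b that permutes_not_in[OF pn, of i] by (simp add: exponents_def)
  ultimately show ?thesis using b by (simp add: exponents_def)
qed

text \<open>Only constants depending on \<open>d\<close> have to be outweighed, so one threshold
  serves all parity classes, all vectors and all choices of the fixed monomial.\<close>

lemma (in gapped_exponent) eventually_class_form_nonneg:
  "\<exists>N. \<forall>n\<ge>N. \<forall>T v. 0 \<le> (\<Sum>b\<in>exponents n d T. \<Sum>c\<in>exponents n d T.
    v b * v c * weight n z (shape {..<n} (\<lambda>i. b i + c i)))"
proof -
  define K where "K = real ((d + 1) ^ d * card {nu :: nat multiset. sum_mset nu \<le> d \<and> (\<forall>r\<in>#nu. 0 < r)})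
      * exp ((d + 1)\<^sup>2)"
  define a :: real where "a = (1 / (4 * d)) ^ (2 * d)"
  have a: "0 < a" using d by (simp add: a_def)
  have "filterlim (\<lambda>n. real n powr \<delta>) at_top sequentially"
    using \<delta>(1) by (intro filterlim_compose[OF real_powr_at_top filterlim_real_sequentially])
  then have "\<forall>\<^sub>F n in sequentially. K / a \<le> real n powr \<delta>"
    by (simp add: filterlim_at_top)
  then obtain N where N: "\<And>n. N \<le> n \<Longrightarrow> K / a \<le> real n powr \<delta>"
    by (auto simp: eventually_sequentially)
  show ?thesis
  proof (intro exI[of _ "max N (4 * d)"] allI impI)
    fix n T v assume n: "max N (4 * d) \<le> n"
    have large: "K \<le> a * n powr \<delta>" using N[of n] n a by (simp add: field_simps)
    let ?F = "exponents n d T" and ?M = "\<lambda>b c. weight n z (shape {..<n} (\<lambda>i. b i + c i))"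
    let ?O = "\<lambda>c. {..<n} - {i. c i \<noteq> 0}"
    \<comment> \<open>Permutations of the variables missing from \<open>c\<close>. They fix
      \<open>c\<close>, which is zero there, and preserve the class because odd exponents are
      nonzero, so \<open>T\<close> lies in the support of \<open>c\<close>.\<close>
    let ?G = "\<lambda>c. (\<lambda>p (b :: nat \<Rightarrow> nat). b \<circ> p) ` {p. p permutes ?O c}"
    show "0 \<le> (\<Sum>b\<in>?F. \<Sum>c\<in>?F. v b * v c * ?M b c)"
    proof (rule quadratic_form_nonneg_by_averaging[where G = ?G])
      show "finite ?F" by (rule finite_exponents)
      show "?M b c = ?M c b" for b c by (simp add: add.commute)
    next
      fix c assume c: "c \<in> ?F"
      have T_pos: "0 < c i" if "i \<in> T" for i
      proof (rule odd_pos)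
        show "odd (c i)" using c that by (simp add: exponents_def)
      qed
      then have disj: "?O c \<inter> T = {}" by fastforce
      show "finite (?G c)" by (intro finite_imageI finite_permutations) simp
      show "id \<in> ?G c" by (rule image_eqI[of _ _ id]) (auto simp: permutes_id)
      {
        fix g assume "g \<in> ?G c"
        then obtain p where p: "p permutes ?O c" and g: "g = (\<lambda>b. b \<circ> p)" by auto
        have pn: "p permutes {..<n}" by (rule permutes_subset[OF p]) auto
        have ginv: "g (b \<circ> inv p) = b" "g b \<circ> inv p = b" for b
          using permutes_inv_o[OF p] by (simp_all add: g comp_assoc)
        show "bij g"
          by (rule o_bij[of "\<lambda>b. b \<circ> inv p"]) (auto simp: ginv)
        show "g ` ?F = ?F"
        proof
          show "g ` ?F \<subseteq> ?F" using comp_permutes_in_exponents[OF _ p _ disj] by (auto simp: g)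
          show "?F \<subseteq> g ` ?F"
          proof
            fix b assume "b \<in> ?F"
            then have "b \<circ> inv p \<in> ?F"
              using comp_permutes_in_exponents[OF _ permutes_inv[OF p] _ disj] by auto
            then show "b \<in> g ` ?F" using ginv(1)[of b] by (metis imageI)
          qed
        qed
        show "g c = c"
        proof
          fix i
          show "g c i = c i"
          proof (cases "i \<in> ?O c")
            case True
            then have "p i \<in> ?O c" using permutes_in_image[OF p] by blast
            with True show ?thesis by (simp add: g)
          qed (simp add: g permutes_not_in[OF p])
        qed
        show "?M (g a) (g b) = ?M a b" for a b
          using shape_comp_permutes[OF pn, of "\<lambda>i. a i + b i"] by (simp add: g)
        fix h assume "h \<in> ?G c"
        then obtain q where q: "q permutes ?O c" and h: "h = (\<lambda>b. b \<circ> q)" by auto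
        have "h \<circ> g = (\<lambda>b. b \<circ> (p \<circ> q))" by (simp add: h g comp_def)
        then show "h \<circ> g \<in> ?G c" using permutes_compose[OF q p] by blast
      }
      fix w :: "(nat \<Rightarrow> nat) \<Rightarrow> real"
      assume w: "\<And>g b. g \<in> ?G c \<Longrightarrow> b \<in> ?F \<Longrightarrow> w (g b) = w b"
      define W where "W = {i. c i \<noteq> 0}"
      have Wn: "W \<subseteq> {..<n}" using c by (auto simp: W_def exponents_def intro: leI)
      have "W = {i\<in>{..<n}. c i \<noteq> 0}" using Wn by (auto simp: W_def)
      then have "card W = size (shape {..<n} c)" by (simp add: size_shape)
      also have "\<dots> \<le> sum_mset (shape {..<n} c)"
        by (rule size_le_sum_mset) (simp add: in_shape_iff)
      also have "\<dots> = d" using c by (simp add: sum_mset_shape exponents_def)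
      finally have Wd: "card W \<le> d" .
      interpret marked_exponents d z \<delta> n W T
        by unfold_locales (use Wn Wd n c T_pos in \<open>auto simp: W_def\<close>)
      have "0 \<le> (\<Sum>b\<in>?F. \<Sum>c\<in>?F. w b * w c * kernel b c)"
      proof (rule invariant_form_nonneg)
        show "real ((d + 1) ^ d * card {nu :: nat multiset. sum_mset nu \<le> d \<and> (\<forall>r\<in>#nu. 0 < r)})
          * exp ((d + 1)\<^sup>2) \<le> (1 / (4 * d)) ^ (2 * d) * n powr \<delta>"
          using large by (simp only: K_def a_def)
        fix b b' assume b: "b \<in> ?F" and b': "b' \<in> ?F" and k: "key b = key b'"
        then have r: "restrict b W = restrict b' W" and "shape ({..<n} - W) b = shape ({..<n} - W) b'"
          by (simp_all add: key_def)
        \<comment> \<open>Equal keys mean equal orbits: \<open>p\<close> matches the exponents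
          outside \<open>W\<close>, and the first components of the keys give agreement on
          \<open>W\<close>.\<close>
        then obtain p where p: "p permutes ({..<n} - W)" and bp: "\<And>i. i \<in> {..<n} - W \<Longrightarrow> b i = b' (p i)"
          using ex_permutation_of_shape_eq[of "{..<n} - W" b b'] by auto
        have "b i = b' (p i)" for i
        proof -
          consider "i \<in> {..<n} - W" | "i \<in> W" | "n \<le> i" by fastforce
          then show ?thesis
          proof cases
            case 2
            then have "b i = b' i" using fun_cong[OF r, of i] by simp
            then show ?thesis using 2 permutes_not_in[OF p, of i] by simp
          next
            case 3
            then show ?thesis using b b' permutes_not_in[OF p, of i] by (simp add: exponents_def)
          qed (rule bp)
        qed
        then have "b = b' \<circ> p" by auto
        moreover have "w (b' \<circ> p) = w b'"
          by (rule w[of "\<lambda>b. b \<circ> p", OF _ b']) (use p in \<open>auto simp: W_def\<close>)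
        ultimately show "w b = w b'" by simp
      qed
      then show "0 \<le> (\<Sum>b\<in>?F. \<Sum>c\<in>?F. w b * w c * ?M b c)" by (simp add: kernel_def)
    qed
  qed
qed

section \<open>Homogeneous forms and moments of their squares\<close>

definition homogeneous :: "nat \<Rightarrow> nat \<Rightarrow> rpoly \<Rightarrow> bool" where
  "homogeneous n k p \<longleftrightarrow> (\<forall>m\<in>Poly_Mapping.keys p.
     Poly_Mapping.keys m \<subseteq> {..<n} \<and> (\<Sum>i<n. Poly_Mapping.lookup m i) = k)"

lemma homogeneous_add: "homogeneous n k p \<Longrightarrow> homogeneous n k q \<Longrightarrow> homogeneous n k (p + q)"
  using Poly_Mapping.keys_add[of p q] by (auto simp: homogeneous_def)

lemma homogeneous_zero: "homogeneous n k 0"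
  by (simp add: homogeneous_def)

lemma homogeneous_sum: "(\<And>i. i \<in> A \<Longrightarrow> homogeneous n k (f i)) \<Longrightarrow> homogeneous n k (sum f A)"
  by (induction A rule: infinite_finite_induct) (auto intro: homogeneous_add homogeneous_zero)

lemma homogeneous_mult:
  assumes "homogeneous n j p" "homogeneous n k q"
  shows "homogeneous n (j + k) (p * q)"
  unfolding homogeneous_def
proof
  fix m assume "m \<in> Poly_Mapping.keys (p * q)"
  then obtain a b where m: "m = a + b" "a \<in> Poly_Mapping.keys p" "b \<in> Poly_Mapping.keys q"
    using Poly_Mapping.keys_mult[of p q] by blast
  then show "Poly_Mapping.keys m \<subseteq> {..<n} \<and> (\<Sum>i<n. Poly_Mapping.lookup m i) = j + k"
    using assms Poly_Mapping.keys_add[of a b] unfolding homogeneous_def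
    by (fastforce simp: lookup_add sum.distrib)
qed

lemma homogeneous_Const: "homogeneous n 0 (Const a)"
  by (auto simp: homogeneous_def Const_def)

lemma homogeneous_power_sum: "homogeneous n r (power_sum n r)"
  unfolding power_sum_def
proof (rule homogeneous_sum)
  fix i assume "i \<in> {..<n}"
  then show "homogeneous n r (Var i ^ r)"
    by (auto simp: homogeneous_def Var_power lookup_single when_def)
qed

lemma homogeneous_power_sum_product: "homogeneous n (sum_mset l) (power_sum_product n l)"
proof (induction l)
  case empty
  have "Const 1 = 1" by (simp add: Const_def)
  then show ?case using homogeneous_Const[of n 1] by simp
qed (simp add: homogeneous_mult homogeneous_power_sum)

lemma lookup_mult_eq:
  "Poly_Mapping.lookup (p * q) m = (\<Sum>a\<in>Poly_Mapping.keys p. \<Sum>b\<in>Poly_Mapping.keys q.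
     if a + b = m then Poly_Mapping.lookup p a * Poly_Mapping.lookup q b else 0)"
  for p q :: rpoly
  unfolding mult_eq_sum_single[of p q] by (simp add: lookup_sum lookup_single when_def)

lemma lookup_sum_list: "Poly_Mapping.lookup (\<Sum>q\<leftarrow>qs. f q) m = (\<Sum>q\<leftarrow>qs. Poly_Mapping.lookup (f q) m)"
  by (induction qs) (simp_all add: lookup_add)

text \<open>
  An exponent \<open>m\<close> occurring in the summands and maximal for a strictly convex function is not the
  midpoint of two others, so \<open>2 m\<close> survives in the sum. The convex function
  \<open>(d\<^sup>2 + 1) (deg m - d)\<^sup>2 + \<bar>m\<bar>\<^sup>2\<close> is at most \<open>d\<^sup>2\<close> at such an \<open>m\<close>, hence everywhere.
\<close>

lemma squares_of_homogeneous_sum: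
  assumes qs: "set qs \<subseteq> polys_in n" and hom: "homogeneous n (2 * d) (\<Sum>q\<leftarrow>qs. q ^ 2)" and q: "q \<in> set qs"
  shows "homogeneous n d q"
proof -
  let ?deg = "\<lambda>m :: nat \<Rightarrow>\<^sub>0 nat. \<Sum>i<n. real (Poly_Mapping.lookup m i)"
  define h where "h m = (real d ^ 2 + 1) * (?deg m - d)\<^sup>2 + (\<Sum>i<n. (real (Poly_Mapping.lookup m i))\<^sup>2)" for m
  define A where "A = (\<Union>q\<in>set qs. Poly_Mapping.keys q)"
  have keys: "Poly_Mapping.keys m \<subseteq> {..<n}" if "m \<in> A" for m
    using qs that by (auto simp: A_def polys_in_def)
  have "finite A" by (simp add: A_def)
  show ?thesis
  proof (cases "A = {}")
    case True
    then show ?thesis using q by (auto simp: A_def homogeneous_def)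
  next
    case False
    then have "Max (h ` A) \<in> h ` A" using \<open>finite A\<close> by (intro Max_in) auto
    then obtain m where m: "m \<in> A" and hm_max: "Max (h ` A) = h m" by auto
    have max: "h a \<le> h m" if "a \<in> A" for a
      using \<open>finite A\<close> that by (simp add: hm_max[symmetric])
    have unique: "a = m \<and> b = m" if ab: "a \<in> A" "b \<in> A" "a + b = m + m" for a b
    proof -
      have sum2: "real (Poly_Mapping.lookup a i) + real (Poly_Mapping.lookup b i) = 2 * real (Poly_Mapping.lookup m i)" for i
        using arg_cong[OF ab(3), of "\<lambda>c. Poly_Mapping.lookup c i"] by (simp add: lookup_add)
      have para: "x\<^sup>2 + y\<^sup>2 = 2 * w\<^sup>2 + (x - y)\<^sup>2 / 2" if "x + y = 2 * w" for x y w :: real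
        using that by (simp add: power2_eq_square field_simps) algebra
      have degs: "?deg a + ?deg b = 2 * ?deg m"
        by (simp add: sum.distrib[symmetric] sum_distrib_left sum2)
      have "(?deg a - d)\<^sup>2 + (?deg b - d)\<^sup>2 = 2 * (?deg m - d)\<^sup>2 + ((?deg a - d) - (?deg b - d))\<^sup>2 / 2"
        by (rule para) (use degs in simp)
      then have "2 * (?deg m - d)\<^sup>2 \<le> (?deg a - d)\<^sup>2 + (?deg b - d)\<^sup>2" by simp
      then have 1: "(real d ^ 2 + 1) * (2 * (?deg m - d)\<^sup>2) \<le> (real d ^ 2 + 1) * ((?deg a - d)\<^sup>2 + (?deg b - d)\<^sup>2)"
        by (rule mult_left_mono) simp
      have 2: "(\<Sum>i<n. (real (Poly_Mapping.lookup a i))\<^sup>2) + (\<Sum>i<n. (real (Poly_Mapping.lookup b i))\<^sup>2) =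
          2 * (\<Sum>i<n. (real (Poly_Mapping.lookup m i))\<^sup>2)
          + (\<Sum>i<n. (real (Poly_Mapping.lookup a i) - real (Poly_Mapping.lookup b i))\<^sup>2 / 2)"
        unfolding sum.distrib[symmetric] sum_distrib_left by (intro sum.cong refl para sum2)
      have "h a + h b \<le> h m + h m" using max ab by (intro add_mono) auto
      then have "(\<Sum>i<n. (real (Poly_Mapping.lookup a i) - real (Poly_Mapping.lookup b i))\<^sup>2 / 2) \<le> 0"
        using 1 2 unfolding h_def by (simp add: algebra_simps)
      then have "(\<Sum>i<n. (real (Poly_Mapping.lookup a i) - real (Poly_Mapping.lookup b i))\<^sup>2 / 2) = 0"
        by (intro antisym sum_nonneg) auto
      then have "Poly_Mapping.lookup a i = Poly_Mapping.lookup b i" if "i < n" for i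
        using that by (subst (asm) sum_nonneg_eq_0_iff) auto
      moreover have "Poly_Mapping.lookup a i = 0" "Poly_Mapping.lookup b i = 0" if "\<not> i < n" for i
        using keys[OF ab(1)] keys[OF ab(2)] that by (auto simp: in_keys_iff)
      ultimately have "a = b" by (intro poly_mapping_eqI) metis
      moreover have "a = m" using sum2 \<open>a = b\<close> by (intro poly_mapping_eqI) simp
      ultimately show ?thesis by simp
    qed
    have square: "Poly_Mapping.lookup (q ^ 2) (m + m) = (Poly_Mapping.lookup q m)\<^sup>2" if q: "q \<in> set qs" for q
    proof -
      let ?t = "\<lambda>a b. if a = m then (if b = m then Poly_Mapping.lookup q a * Poly_Mapping.lookup q b else 0) else 0"
      have "Poly_Mapping.lookup (q ^ 2) (m + m) = (\<Sum>a\<in>Poly_Mapping.keys q. \<Sum>b\<in>Poly_Mapping.keys q. ?t a b)"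
        unfolding power2_eq_square lookup_mult_eq
        using unique q by (intro sum.cong refl) (auto simp: A_def)
      also have "\<dots> = (\<Sum>a\<in>Poly_Mapping.keys q. if a = m then \<Sum>b\<in>Poly_Mapping.keys q.
          (if b = m then Poly_Mapping.lookup q a * Poly_Mapping.lookup q b else 0) else 0)"
        by (intro sum.cong refl) auto
      also have "\<dots> = (Poly_Mapping.lookup q m)\<^sup>2"
        by (simp add: power2_eq_square in_keys_iff)
      finally show ?thesis .
    qed
    have "Poly_Mapping.lookup (\<Sum>q\<leftarrow>qs. q ^ 2) (m + m) = (\<Sum>q\<leftarrow>qs. (Poly_Mapping.lookup q m)\<^sup>2)"
      unfolding lookup_sum_list by (intro arg_cong[of _ _ sum_list] map_cong refl square)
    moreover have "(\<Sum>q\<leftarrow>qs. (Poly_Mapping.lookup q m)\<^sup>2) \<noteq> 0"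
      using m by (subst sum_list_nonneg_eq_0_iff) (auto simp: A_def in_keys_iff)
    ultimately have "m + m \<in> Poly_Mapping.keys (\<Sum>q\<leftarrow>qs. q ^ 2)" by (simp add: in_keys_iff)
    then have "(\<Sum>i<n. Poly_Mapping.lookup (m + m) i) = 2 * d" using hom by (simp add: homogeneous_def)
    then have deg_nat: "(\<Sum>i<n. Poly_Mapping.lookup m i) = d"
      by (simp add: lookup_add sum.distrib)
    then have deg: "?deg m = d" by (simp flip: of_nat_sum)
    have "(\<Sum>i<n. (real (Poly_Mapping.lookup m i))\<^sup>2) \<le> (\<Sum>i<n. real d * real (Poly_Mapping.lookup m i))"
      unfolding power2_eq_square
      using member_le_sum[of _ "{..<n}" "Poly_Mapping.lookup m"] deg_nat
      by (intro sum_mono mult_right_mono) auto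
    also have "\<dots> = real d ^ 2" by (simp add: sum_distrib_left[symmetric] deg power2_eq_square)
    finally have hm: "h m \<le> real d ^ 2" by (simp add: h_def deg)
    show ?thesis unfolding homogeneous_def
    proof
      fix a assume "a \<in> Poly_Mapping.keys q"
      then have a: "a \<in> A" using q by (auto simp: A_def)
      \<comment> \<open>A degree other than \<open>d\<close> is off by at least 1, which would make
        the first term of \<open>h\<close> at least d^2 + 1, above the maximum.\<close>
      have "(real d ^ 2 + 1) * (?deg a - d)\<^sup>2 \<le> h a" by (simp add: h_def sum_nonneg)
      also have "\<dots> < real d ^ 2 + 1" using max[OF a] hm by simp
      finally have "(?deg a - d)\<^sup>2 < 1" by (simp add: mult_less_cancel_left2 add_pos_nonneg)
      then have "\<bar>?deg a - d\<bar> < 1" by (simp add: abs_square_less_1)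
      then have "(\<Sum>i<n. Poly_Mapping.lookup a i) = d"
        by (simp only: of_nat_sum[symmetric])
      then show "Poly_Mapping.keys a \<subseteq> {..<n} \<and> (\<Sum>i<n. Poly_Mapping.lookup a i) = d"
        using keys[OF a] by simp
    qed
  qed
qed

text \<open>The product of two monomials from different parity classes has an odd exponent, where
  \<open>weight\<close> is zero. Hence the moment of the square is a sum of class forms.\<close>

lemma moment_square_nonneg:
  assumes hom: "homogeneous n d q"
    and psd: "\<And>T v. 0 \<le> (\<Sum>b\<in>exponents n d T. \<Sum>c\<in>exponents n d T.
      v b * v c * weight n z (shape {..<n} (\<lambda>i. b i + c i)))"
  shows "0 \<le> moment n z (q ^ 2)"
proof -
  let ?odd = "\<lambda>a :: nat \<Rightarrow>\<^sub>0 nat. {i. odd (Poly_Mapping.lookup a i)}"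
  let ?K = "Poly_Mapping.keys q"
  define M where "M a b = Poly_Mapping.lookup q a * Poly_Mapping.lookup q b *
     weight n z (shape {..<n} (\<lambda>i. Poly_Mapping.lookup a i + Poly_Mapping.lookup b i))" for a b
  have outside: "Poly_Mapping.lookup a i = 0" if "a \<in> ?K" "n \<le> i" for a i
    using hom that unfolding homogeneous_def by (metis in_keys_iff lessThan_iff not_le subsetD)
  have off: "M a b = 0" if ab: "a \<in> ?K" "b \<in> ?K" "?odd a \<noteq> ?odd b" for a b
  proof -
    obtain i where i: "odd (Poly_Mapping.lookup a i + Poly_Mapping.lookup b i)" using ab(3) by auto
    have "i < n" using outside[OF ab(1), of i] outside[OF ab(2), of i] i by (cases "i < n") auto
    then have "\<exists>r\<in>#shape {..<n} (\<lambda>i. Poly_Mapping.lookup a i + Poly_Mapping.lookup b i). odd r"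
      using i by (intro bexI[of _ "Poly_Mapping.lookup a i + Poly_Mapping.lookup b i"])
        (auto simp: in_shape_iff intro!: odd_pos exI[of _ i])
    then show ?thesis by (auto simp: M_def weight_def)
  qed
  have diag: "0 \<le> (\<Sum>a\<in>{a\<in>?K. ?odd a = T}. \<Sum>b\<in>{b\<in>?K. ?odd b = T}. M a b)" for T
  proof -
    let ?A = "{a\<in>?K. ?odd a = T}" and ?E = "exponents n d T"
    \<comment> \<open>The coefficients of \<open>q\<close> as a vector on the whole class, zero at
      exponents that do not occur in \<open>q\<close>.\<close>
    define v where "v f = Poly_Mapping.lookup q (Poly_Mapping.Abs_poly_mapping f)" for f
    have v: "v (Poly_Mapping.lookup a) = Poly_Mapping.lookup q a" for a
      by (simp add: v_def lookup_inverse)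
    have sub: "Poly_Mapping.lookup ` ?A \<subseteq> ?E"
      using hom outside by (auto simp: exponents_def homogeneous_def)
    have zero: "v f = 0" if f: "f \<in> ?E - Poly_Mapping.lookup ` ?A" for f
    proof (rule ccontr)
      assume "v f \<noteq> 0"
      moreover have "finite {i. f i \<noteq> 0}"
        by (rule finite_subset[of _ "{..<n}"]) (use f in \<open>auto simp: exponents_def intro: leI\<close>)
      then have f_eq: "Poly_Mapping.lookup (Poly_Mapping.Abs_poly_mapping f) = f"
        by (simp add: Abs_poly_mapping_inverse)
      ultimately have "Poly_Mapping.Abs_poly_mapping f \<in> ?A"
        using f by (auto simp: in_keys_iff v_def exponents_def)
      from imageI[OF this, of Poly_Mapping.lookup] show False using f unfolding f_eq by simp
    qed
    have inj: "inj_on Poly_Mapping.lookup ?A" by (rule inj_onI) (simp only: lookup_inject)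
    have "(\<Sum>f\<in>?E. \<Sum>g\<in>?E. v f * v g * weight n z (shape {..<n} (\<lambda>i. f i + g i))) =
      (\<Sum>f\<in>Poly_Mapping.lookup ` ?A. \<Sum>g\<in>Poly_Mapping.lookup ` ?A. v f * v g * weight n z (shape {..<n} (\<lambda>i. f i + g i)))"
    proof (rule sum.mono_neutral_cong_right)
      fix f assume "f \<in> Poly_Mapping.lookup ` ?A"
      show "(\<Sum>g\<in>?E. v f * v g * weight n z (shape {..<n} (\<lambda>i. f i + g i))) =
          (\<Sum>g\<in>Poly_Mapping.lookup ` ?A. v f * v g * weight n z (shape {..<n} (\<lambda>i. f i + g i)))"
        by (rule sum.mono_neutral_right) (use finite_exponents sub zero in auto)
    qed (use finite_exponents sub zero in auto)
    also have "\<dots> = (\<Sum>a\<in>?A. \<Sum>b\<in>?A. M a b)"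
      unfolding sum.reindex[OF inj] by (simp add: M_def v)
    finally show ?thesis using psd[where T = T and v = v] by simp
  qed
  have "moment n z (q ^ 2) = (\<Sum>a\<in>?K. \<Sum>b\<in>?K. 1 * 1 * M a b)"
    by (simp add: power2_eq_square moment_mult M_def plus_poly_mapping.rep_eq)
  also have "\<dots> = (\<Sum>T\<in>?odd ` ?K. \<Sum>T'\<in>?odd ` ?K. 1 * 1 * (\<Sum>a\<in>{a\<in>?K. ?odd a = T}. \<Sum>b\<in>{b\<in>?K. ?odd b = T'}. M a b))"
    by (rule sum_over_pairs_by_key[where w = "\<lambda>_. 1"]) simp
  also have "0 \<le> \<dots>"
  proof (intro sum_nonneg)
    fix T T'
    show "0 \<le> 1 * 1 * (\<Sum>a\<in>{a\<in>?K. ?odd a = T}. \<Sum>b\<in>{b\<in>?K. ?odd b = T'}. M a b)"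
    proof (cases "T = T'")
      case True
      then show ?thesis using diag[of T] by simp
    next
      case False
      have "(\<Sum>a\<in>{a\<in>?K. ?odd a = T}. \<Sum>b\<in>{b\<in>?K. ?odd b = T'}. M a b) = 0"
        using False by (intro sum.neutral ballI off) auto
      then show ?thesis by simp
    qed
  qed
  finally show ?thesis .
qed

text \<open>For given \<open>n\<close>, an element of \<open>BSigma\<close> is tested through its
  representation in exactly \<open>n\<close> variables. The form is homogeneous, which forces degree
  \<open>d\<close> on every summand.\<close>

lemma (in gapped_exponent) eventually_moments_in_dual_cone:
  "\<exists>N. \<forall>n\<ge>N. restrict (\<lambda>l. moment n z (power_sum_product n l)) (even_partitions (2 * d)) \<in>
    dual_cone (even_partitions (2 * d)) (BSigma (2 * d))"
proof -
  let ?I = "even_partitions (2 * d)"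
  obtain N where N: "\<And>n T v. N \<le> n \<Longrightarrow> 0 \<le> (\<Sum>b\<in>exponents n d T. \<Sum>c\<in>exponents n d T.
      v b * v c * weight n z (shape {..<n} (\<lambda>i. b i + c i)))"
    using eventually_class_form_nonneg by blast
  show ?thesis
  proof (intro exI[of _ "max N (2 * d)"] allI impI)
    fix n assume n: "max N (2 * d) \<le> n"
    show "restrict (\<lambda>l. moment n z (power_sum_product n l)) ?I \<in> dual_cone ?I (BSigma (2 * d))"
      unfolding dual_cone_def
    proof (intro CollectI conjI ballI)
      fix c assume "c \<in> BSigma (2 * d)"
      let ?f = "\<Sum>l\<in>?I. Const (c l) * power_sum_product n l"
      obtain qs where qs: "set qs \<subseteq> polys_in n" "?f = (\<Sum>q\<leftarrow>qs. q ^ 2)"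
        using \<open>c \<in> BSigma (2 * d)\<close> n by (auto simp: BSigma_def sum_of_squares_def)
      have "homogeneous n (2 * d) ?f"
      proof (rule homogeneous_sum)
        fix l assume "l \<in> ?I"
        then show "homogeneous n (2 * d) (Const (c l) * power_sum_product n l)"
          using homogeneous_mult[OF homogeneous_Const homogeneous_power_sum_product[of n l]]
          by (simp add: even_partitions_def)
      qed
      then have "0 \<le> moment n z (q ^ 2)" if "q \<in> set qs" for q
        using moment_square_nonneg[OF squares_of_homogeneous_sum[OF qs(1) _ that] N] qs(2) n by simp
      then have "0 \<le> moment n z ?f"
        unfolding qs(2) moment_sum_list by (intro sum_list_nonneg) auto
      also have "\<dots> = (\<Sum>l\<in>?I. c l * restrict (\<lambda>l. moment n z (power_sum_product n l)) ?I l)"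
        unfolding moment_sum moment_Const by (intro sum.cong) auto
      finally show "0 \<le> (\<Sum>l\<in>?I. c l * restrict (\<lambda>l. moment n z (power_sum_product n l)) ?I l)" .
    qed auto
  qed
qed

section \<open>Inequalities on the dual cone\<close>

lemma polys_in_add: "p \<in> polys_in n \<Longrightarrow> q \<in> polys_in n \<Longrightarrow> p + q \<in> polys_in n"
  using Poly_Mapping.keys_add[of p q] by (auto simp: polys_in_def)

lemma polys_in_uminus: "p \<in> polys_in n \<Longrightarrow> - p \<in> polys_in n"
  by (simp add: polys_in_def)

lemma polys_in_diff: "p \<in> polys_in n \<Longrightarrow> q \<in> polys_in n \<Longrightarrow> p - q \<in> polys_in n"
  using polys_in_add[of p n "- q"] polys_in_uminus[of q n] by simp

lemma polys_in_mult:
  assumes "p \<in> polys_in n" "q \<in> polys_in n"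
  shows "p * q \<in> polys_in n"
  unfolding polys_in_def
proof (intro CollectI ballI)
  fix m assume "m \<in> Poly_Mapping.keys (p * q)"
  then obtain a b where "m = a + b" "a \<in> Poly_Mapping.keys p" "b \<in> Poly_Mapping.keys q"
    using Poly_Mapping.keys_mult[of p q] by blast
  then show "Poly_Mapping.keys m \<subseteq> {..<n}"
    using assms Poly_Mapping.keys_add[of a b] by (fastforce simp: polys_in_def)
qed

lemma homogeneous_polys_in: "homogeneous n k p \<Longrightarrow> p \<in> polys_in n"
  by (auto simp: homogeneous_def polys_in_def)

lemma polys_in_power_sum_product: "power_sum_product n l \<in> polys_in n"
  by (rule homogeneous_polys_in[OF homogeneous_power_sum_product])

lemma polys_in_Const: "Const a \<in> polys_in n"
  by (rule homogeneous_polys_in[OF homogeneous_Const])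

lemma polys_in_Var_power: "i < n \<Longrightarrow> Var i ^ r \<in> polys_in n"
  by (auto simp: polys_in_def Var_power)

lemma sum_of_squares_square: "q \<in> polys_in n \<Longrightarrow> sum_of_squares n (q ^ 2)"
  unfolding sum_of_squares_def by (intro exI[of _ "[q]"]) simp

lemma sum_of_squares_zero: "sum_of_squares n 0"
  unfolding sum_of_squares_def by (intro exI[of _ "[]"]) simp

lemma sum_of_squares_add:
  assumes "sum_of_squares n f" "sum_of_squares n g"
  shows "sum_of_squares n (f + g)"
proof -
  obtain ps qs where "set ps \<subseteq> polys_in n" "f = (\<Sum>q\<leftarrow>ps. q ^ 2)" "set qs \<subseteq> polys_in n" "g = (\<Sum>q\<leftarrow>qs. q ^ 2)"
    using assms by (auto simp: sum_of_squares_def)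
  then show ?thesis unfolding sum_of_squares_def by (intro exI[of _ "ps @ qs"]) simp
qed

lemma sum_of_squares_sum: "(\<And>i. i \<in> A \<Longrightarrow> sum_of_squares n (f i)) \<Longrightarrow> sum_of_squares n (sum f A)"
  by (induction A rule: infinite_finite_induct) (auto intro: sum_of_squares_zero sum_of_squares_add)

lemma sum_of_squares_mult_square:
  assumes "q \<in> polys_in n" "sum_of_squares n f"
  shows "sum_of_squares n (q ^ 2 * f)"
proof -
  obtain ps where ps: "set ps \<subseteq> polys_in n" "f = (\<Sum>p\<leftarrow>ps. p ^ 2)"
    using assms(2) by (auto simp: sum_of_squares_def)
  have "q ^ 2 * f = (\<Sum>p\<leftarrow>map (\<lambda>p. q * p) ps. p ^ 2)"
    by (simp add: ps(2) sum_list_const_mult[symmetric] power_mult_distrib comp_def)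
  moreover have "set (map (\<lambda>p. q * p) ps) \<subseteq> polys_in n"
    using ps(1) assms(1) by (auto intro: polys_in_mult)
  ultimately show ?thesis unfolding sum_of_squares_def by blast
qed

lemma sum_of_squares_mult:
  assumes "sum_of_squares n f" "sum_of_squares n g"
  shows "sum_of_squares n (f * g)"
proof -
  obtain ps where ps: "set ps \<subseteq> polys_in n" "f = (\<Sum>p\<leftarrow>ps. p ^ 2)"
    using assms(1) by (auto simp: sum_of_squares_def)
  have "sum_of_squares n ((\<Sum>p\<leftarrow>ps. p ^ 2) * g)" using ps(1)
    by (induction ps)
       (auto simp: distrib_right intro: sum_of_squares_zero sum_of_squares_add sum_of_squares_mult_square assms(2))
  then show ?thesis by (simp add: ps(2))
qed

lemma sum_of_squares_even_power_sum_product: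
  assumes "\<forall>r\<in>#l. even r"
  shows "sum_of_squares n (power_sum_product n l)"
  using assms
proof (induction l)
  case empty
  have "(1 :: rpoly) = Const 1 ^ 2" by (simp add: Const_def)
  then show ?case using sum_of_squares_square[OF polys_in_Const[of 1 n]] by simp
next
  case (add r l)
  then obtain s where s: "r = s * 2" by (auto elim!: evenE simp: mult.commute)
  have "sum_of_squares n (power_sum n r)"
    unfolding power_sum_def s power_mult
    by (intro sum_of_squares_sum sum_of_squares_square polys_in_Var_power) simp
  then show ?case using add by (simp add: sum_of_squares_mult)
qed

text \<open>The diagonal terms of the product of two power sums form the merged one. What remains
  are the terms with distinct indices, which are squares because \<open>a\<close> and
  \<open>b\<close> are even.\<close>

lemma sum_of_squares_merge:
  assumes "even a" "even b" "\<forall>r\<in>#mu. even r"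
  shows "sum_of_squares n (power_sum_product n (add_mset a (add_mset b mu)) - power_sum_product n (add_mset (a + b) mu))"
proof -
  obtain a' b' where ab: "a = a' * 2" "b = b' * 2"
    using assms by (auto elim!: evenE simp: mult.commute)
  let ?t = "\<lambda>i j. if i = j then 0 else Var i ^ a * Var j ^ b"
  have "(\<Sum>i<n. \<Sum>j<n. ?t i j) = (\<Sum>i<n. \<Sum>j<n. Var i ^ a * Var j ^ b - (if i = j then Var i ^ a * Var j ^ b else 0))"
    by (intro sum.cong refl) auto
  also have "\<dots> = power_sum n a * power_sum n b - power_sum n (a + b)"
    by (simp add: sum_subtractf sum_product power_sum_def power_add)
  finally have eq: "power_sum n a * power_sum n b - power_sum n (a + b) = (\<Sum>i<n. \<Sum>j<n. ?t i j)" ..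
  have "sum_of_squares n (\<Sum>i<n. \<Sum>j<n. ?t i j)"
  proof (intro sum_of_squares_sum)
    fix i j assume "i \<in> {..<n}" "j \<in> {..<n}"
    then have "Var i ^ a' * Var j ^ b' \<in> polys_in n"
      by (auto intro: polys_in_mult polys_in_Var_power)
    from sum_of_squares_square[OF this] show "sum_of_squares n (?t i j)"
      by (simp add: ab power_mult power_mult_distrib sum_of_squares_zero)
  qed
  then have "sum_of_squares n ((power_sum n a * power_sum n b - power_sum n (a + b)) * power_sum_product n mu)"
    unfolding eq by (intro sum_of_squares_mult sum_of_squares_even_power_sum_product assms)
  then show ?thesis by (simp add: algebra_simps)
qed

text \<open>
  Expanding the first factor of each of the three products gives a sum over \<open>i\<close> of expressions of
  the same form, with \<open>f\<close>, \<open>g\<close> replaced by \<open>X\<^sub>i\<^sup>a f\<close>, \<open>X\<^sub>i\<^sup>b g\<close>.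
\<close>

lemma sum_of_squares_pairs:
  assumes "f \<in> polys_in n" "g \<in> polys_in n"
  shows "sum_of_squares n (power_sum_product n (image_mset (\<lambda>(a, b). 2 * a) P) * f ^ 2
    - 2 * power_sum_product n (image_mset (\<lambda>(a, b). a + b) P) * (f * g)
    + power_sum_product n (image_mset (\<lambda>(a, b). 2 * b) P) * g ^ 2)"
  using assms
proof (induction P arbitrary: f g)
  case empty
  have "f ^ 2 - 2 * (f * g) + g ^ 2 = (f - g) ^ 2" by (simp add: power2_eq_square algebra_simps)
  then show ?case using sum_of_squares_square[OF polys_in_diff[OF empty]] by simp
next
  case (add ab P)
  obtain a b where ab: "ab = (a, b)" by fastforce
  let ?A = "power_sum_product n (image_mset (\<lambda>(a, b). 2 * a) P)"
  let ?B = "power_sum_product n (image_mset (\<lambda>(a, b). a + b) P)"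
  let ?C = "power_sum_product n (image_mset (\<lambda>(a, b). 2 * b) P)"
  have "sum_of_squares n (\<Sum>i<n. ?A * (Var i ^ a * f) ^ 2 - 2 * ?B * ((Var i ^ a * f) * (Var i ^ b * g)) + ?C * (Var i ^ b * g) ^ 2)"
    using add.prems by (intro sum_of_squares_sum add.IH polys_in_mult polys_in_Var_power) auto
  also have "(\<Sum>i<n. ?A * (Var i ^ a * f) ^ 2 - 2 * ?B * ((Var i ^ a * f) * (Var i ^ b * g)) + ?C * (Var i ^ b * g) ^ 2) =
      power_sum n (2 * a) * ?A * f ^ 2 - 2 * (power_sum n (a + b) * ?B) * (f * g) + power_sum n (2 * b) * ?C * g ^ 2"
  proof -
    have ring: "A * (X * f) ^ 2 - 2 * B * ((X * f) * (Y * g)) + C * (Y * g) ^ 2 =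
        X * X * A * f ^ 2 - 2 * (X * Y * B) * (f * g) + Y * Y * C * g ^ 2" for A B C X Y :: rpoly
      by (simp add: power2_eq_square mult_ac)
    have "power_sum n (a + b) = (\<Sum>i<n. Var i ^ a * Var i ^ b)" for a b
      by (simp add: power_sum_def power_add)
    then show ?thesis
      by (simp only: ring mult_2[of a] mult_2[of b] sum.distrib sum_subtractf sum_distrib_right sum_distrib_left)
  qed
  finally show ?case by (simp add: ab)
qed

section \<open>Passage from sums of squares to the dual cone\<close>

lemma power_sum_product_plus:
  "power_sum_product n (l + l') = power_sum_product n l * power_sum_product n l'"
  by (simp add: power_sum_product_def)

lemma Const_mult: "Const a * Const b = Const (a * b)"
  by (simp add: Const_def mult_single)

lemma Const_add: "Const a + Const b = Const (a + b)"
  by (simp add: Const_def single_add)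

lemma Const_0: "Const 0 = 0"
  by (simp add: Const_def)

lemma Const_neg2: "Const (- 2 * a) = - 2 * Const a"
proof -
  have "Const (- 2 * a) = - (Const a + Const a)" by (simp add: Const_add) (simp add: Const_def single_uminus)
  then show ?thesis by (simp only: mult_minus_left mult_2)
qed

lemma dual_cone_three_terms:
  assumes x: "x \<in> dual_cone (even_partitions k) (BSigma k)"
    and l: "l1 \<in> even_partitions k" "l2 \<in> even_partitions k" "l3 \<in> even_partitions k"
    and sos: "\<And>n. k \<le> n \<Longrightarrow> sum_of_squares n
      (Const a * power_sum_product n l1 + Const b * power_sum_product n l2 + Const c * power_sum_product n l3)"
  shows "0 \<le> a * x l1 + b * x l2 + c * x l3"
proof -
  let ?I = "even_partitions k"
  \<comment> \<open>The contributions are added because the three partitions may coincide.\<close>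
  define e where "e = restrict (\<lambda>l. (if l = l1 then a else 0) + (if l = l2 then b else 0) + (if l = l3 then c else 0)) ?I"
  have poly: "(\<Sum>l\<in>?I. Const (e l) * p l) = Const a * p l1 + Const b * p l2 + Const c * p l3" for p
  proof -
    have "(\<Sum>l\<in>?I. Const (e l) * p l) = (\<Sum>l\<in>?I. (if l = l1 then Const a * p l else 0)
        + (if l = l2 then Const b * p l else 0) + (if l = l3 then Const c * p l else 0))"
      by (intro sum.cong refl) (auto simp: e_def Const_add[symmetric] Const_0 algebra_simps)
    then show ?thesis using l by (simp add: sum.distrib finite_even_partitions)
  qed
  have "(\<Sum>l\<in>?I. e l * x l) = (\<Sum>l\<in>?I. (if l = l1 then a * x l else 0)
      + (if l = l2 then b * x l else 0) + (if l = l3 then c * x l else 0))"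
    by (intro sum.cong refl) (auto simp: e_def algebra_simps)
  then have value_eq: "(\<Sum>l\<in>?I. e l * x l) = a * x l1 + b * x l2 + c * x l3"
    using l by (simp add: sum.distrib finite_even_partitions)
  have "e \<in> BSigma k" using sos by (auto simp: BSigma_def poly) (simp add: e_def)
  then show ?thesis using x by (auto simp: dual_cone_def value_eq[symmetric])
qed

lemma admissible_even_partitions:
  assumes "admissible d P nu rho"
  shows "image_mset (\<lambda>(a, b). 2 * a) P + nu + nu \<in> even_partitions (2 * d)"
    and "image_mset (\<lambda>(a, b). a + b) P + nu + rho \<in> even_partitions (2 * d)"
    and "image_mset (\<lambda>(a, b). 2 * b) P + rho + rho \<in> even_partitions (2 * d)"
proof -
  have sums: "sum_mset (image_mset (\<lambda>(a, b). 2 * a) P) = 2 * sum_mset (image_mset fst P)"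
    "sum_mset (image_mset (\<lambda>(a, b). 2 * b) P) = 2 * sum_mset (image_mset snd P)"
    "sum_mset (image_mset (\<lambda>(a, b). a + b) P) = sum_mset (image_mset fst P) + sum_mset (image_mset snd P)"
    for P :: "(nat \<times> nat) multiset"
    by (induction P) auto
  show "image_mset (\<lambda>(a, b). 2 * a) P + nu + nu \<in> even_partitions (2 * d)"
    and "image_mset (\<lambda>(a, b). a + b) P + nu + rho \<in> even_partitions (2 * d)"
    and "image_mset (\<lambda>(a, b). 2 * b) P + rho + rho \<in> even_partitions (2 * d)"
    using assms by (fastforce simp: admissible_def even_partitions_def sums)+
qed

text \<open>A triple (l1, l2, l3) stands for 2 y(l2) \<le> y(l1) + y(l3). Merging gives y(l') \<le>
  y(l), encoded with the same partition \<open>l\<close> in both outer places.\<close>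

definition constraints :: "nat \<Rightarrow> (nat multiset \<times> nat multiset \<times> nat multiset) set" where
  "constraints d =
    {(l, l', l) |a b mu l l'. l = add_mset a (add_mset b mu) \<and> l' = add_mset (a + b) mu \<and> l \<in> even_partitions (2 * d)} \<union>
    {(image_mset (\<lambda>(a, b). 2 * a) P + nu + nu, image_mset (\<lambda>(a, b). a + b) P + nu + rho,
      image_mset (\<lambda>(a, b). 2 * b) P + rho + rho) |P nu rho. admissible d P nu rho}"

lemma constraints_subset:
  "constraints d \<subseteq> even_partitions (2 * d) \<times> even_partitions (2 * d) \<times> even_partitions (2 * d)"
  using admissible_even_partitions[of d] even_partitions_merge unfolding constraints_def by blast

lemma dual_cone_log_convex:
  assumes x: "x \<in> dual_cone (even_partitions (2 * d)) (BSigma (2 * d))"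
    and pos: "\<And>l. l \<in> even_partitions (2 * d) \<Longrightarrow> 0 < x l"
    and "(l1, l2, l3) \<in> constraints d"
  shows "(x l2)\<^sup>2 \<le> x l1 * x l3"
  using assms(3) unfolding constraints_def
proof (elim UnE CollectE exE conjE)
  fix a b mu l l'
  assume eq: "(l1, l2, l3) = (l, l', l)" and l: "l = add_mset a (add_mset b mu)" "l \<in> even_partitions (2 * d)"
    and l': "l' = add_mset (a + b) mu"
  have l'_in: "l' \<in> even_partitions (2 * d)" using even_partitions_merge l l' by simp
  have "0 \<le> 1 * x l + (- 1) * x l' + 0 * x l"
  proof (rule dual_cone_three_terms[OF x])
    fix n
    have "Const 1 = 1" "Const (- 1) = - 1" by (simp_all add: Const_def single_uminus)
    then show "sum_of_squares n (Const 1 * power_sum_product n l + Const (- 1) * power_sum_product n l' + Const 0 * power_sum_product n l)"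
      using sum_of_squares_merge[of a b mu n] l by (auto simp: Const_0 l' even_partitions_def)
  qed (use l l'_in in auto)
  then have "x l' \<le> x l" by simp
  then show ?thesis using eq pos[OF l'_in] by (auto simp: power2_eq_square intro: mult_mono)
next
  fix P nu rho
  assume eq: "(l1, l2, l3) = (image_mset (\<lambda>(a, b). 2 * a) P + nu + nu, image_mset (\<lambda>(a, b). a + b) P + nu + rho,
      image_mset (\<lambda>(a, b). 2 * b) P + rho + rho)" and adm: "admissible d P nu rho"
  have l: "l1 \<in> even_partitions (2 * d)" "l2 \<in> even_partitions (2 * d)" "l3 \<in> even_partitions (2 * d)"
    using admissible_even_partitions[OF adm] eq by auto
  \<comment> \<open>The quadratic form in \<open>s\<close> and \<open>t\<close> obtained from the
    sum of squares takes the value \<open>t * (x l1 * x l3 - (x l2)\<^sup>2)\<close> at this point,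
    and \<open>t\<close> is positive.\<close>
  define s t where "s = x l2" and "t = x l1"
  have "0 \<le> (s * s) * x l1 + (- 2 * (s * t)) * x l2 + (t * t) * x l3"
  proof (rule dual_cone_three_terms[OF x l])
    fix n
    have "sum_of_squares n (power_sum_product n (image_mset (\<lambda>(a, b). 2 * a) P) * (Const s * power_sum_product n nu) ^ 2
      - 2 * power_sum_product n (image_mset (\<lambda>(a, b). a + b) P) * ((Const s * power_sum_product n nu) * (Const t * power_sum_product n rho))
      + power_sum_product n (image_mset (\<lambda>(a, b). 2 * b) P) * (Const t * power_sum_product n rho) ^ 2)"
      by (intro sum_of_squares_pairs polys_in_mult polys_in_Const polys_in_power_sum_product)
    then show "sum_of_squares n (Const (s * s) * power_sum_product n l1 + Const (- 2 * (s * t)) * power_sum_product n l2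
        + Const (t * t) * power_sum_product n l3)"
      using eq unfolding Const_neg2
      by (simp add: power_sum_product_plus Const_mult[symmetric] power2_eq_square mult_ac)
  qed
  then have "0 \<le> t * (x l1 * x l3 - (x l2)\<^sup>2)"
    by (simp add: s_def t_def power2_eq_square algebra_simps)
  moreover have "0 < t" using pos l by (simp add: t_def)
  ultimately show ?thesis by (simp add: zero_le_mult_iff)
qed

lemma trop_dual_cone_constraint:
  assumes y: "y \<in> trop (even_partitions (2 * d)) (dual_cone (even_partitions (2 * d)) (BSigma (2 * d)))"
    and c: "(l1, l2, l3) \<in> constraints d"
  shows "2 * y l2 \<le> y l1 + y l3"
proof -
  let ?I = "even_partitions (2 * d)"
  obtain x \<tau> where x: "\<And>m. x m \<in> dual_cone ?I (BSigma (2 * d))" "\<And>m i. i \<in> ?I \<Longrightarrow> 0 < x m i"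
    and \<tau>: "\<And>m. 0 < \<tau> m" "\<And>m. \<tau> m < 1"
    and lim: "\<And>i. i \<in> ?I \<Longrightarrow> (\<lambda>m. log (1 / \<tau> m) (x m i)) \<longlonglongrightarrow> y i"
    using y unfolding trop_def by blast
  have l: "l1 \<in> ?I" "l2 \<in> ?I" "l3 \<in> ?I" using c constraints_subset by auto
  show ?thesis
  proof (rule LIMSEQ_le)
    show "(\<lambda>m. 2 * log (1 / \<tau> m) (x m l2)) \<longlonglongrightarrow> 2 * y l2"
      by (intro tendsto_intros lim l)
    show "(\<lambda>m. log (1 / \<tau> m) (x m l1) + log (1 / \<tau> m) (x m l3)) \<longlonglongrightarrow> y l1 + y l3"
      by (intro tendsto_intros lim l)
    have "2 * log (1 / \<tau> m) (x m l2) \<le> log (1 / \<tau> m) (x m l1) + log (1 / \<tau> m) (x m l3)" for m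
    proof -
      have b: "1 < 1 / \<tau> m" using \<tau>[of m] by simp
      have "2 * log (1 / \<tau> m) (x m l2) = log (1 / \<tau> m) ((x m l2)\<^sup>2)"
        using log_nat_power[OF less_imp_le[OF x(2)[OF l(2), of m]], of "1 / \<tau> m" 2] by simp
      also have "\<dots> \<le> log (1 / \<tau> m) (x m l1 * x m l3)"
      proof (rule log_mono)
        show "1 < 1 / \<tau> m" by (rule b)
        show "0 < (x m l2)\<^sup>2" using x(2)[OF l(2), of m] by simp
        show "(x m l2)\<^sup>2 \<le> x m l1 * x m l3" by (rule dual_cone_log_convex[OF x(1) x(2) c])
      qed
      also have "\<dots> = log (1 / \<tau> m) (x m l1) + log (1 / \<tau> m) (x m l3)"
        using x(2)[OF l(1), of m] x(2)[OF l(3), of m] b by (simp add: log_mult)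
      finally show ?thesis .
    qed
    then show "\<exists>N. \<forall>m\<ge>N. 2 * log (1 / \<tau> m) (x m l2) \<le> log (1 / \<tau> m) (x m l1) + log (1 / \<tau> m) (x m l3)"
      by blast
  qed
qed

section \<open>The tropicalization\<close>

definition square_sum :: "nat multiset \<Rightarrow> real" where
  "square_sum l = (\<Sum>r\<in>#l. (real r)\<^sup>2)"

definition count_square_sum :: "nat \<Rightarrow> nat multiset \<Rightarrow> real" where
  "count_square_sum k l = (\<Sum>r\<le>k. (real (count l r))\<^sup>2)"

lemma count_square_sum_le:
  assumes "l \<in> even_partitions k"
  shows "count_square_sum k l \<le> (real k + 1) * (real k)\<^sup>2"
proof -
  have "count_square_sum k l \<le> (\<Sum>r\<le>k. (real k)\<^sup>2)"
    unfolding count_square_sum_def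
    using order_trans[OF count_le_size size_even_partition_le[OF assms]] by (intro sum_mono power_mono) auto
  then show ?thesis by (simp add: add.commute)
qed

lemma count_square_sum_nonneg: "0 \<le> count_square_sum k l"
  by (simp add: count_square_sum_def sum_nonneg)

lemma square_sum_pairs:
  "square_sum (image_mset (\<lambda>(a, b). 2 * a) P) + square_sum (image_mset (\<lambda>(a, b). 2 * b) P)
    - 2 * square_sum (image_mset (\<lambda>(a, b). a + b) P) = (\<Sum>(a, b)\<in>#P. 2 * (real a - real b)\<^sup>2)"
  by (induction P) (auto simp: square_sum_def power2_eq_square algebra_simps)

lemma square_sum_plus: "square_sum (l + l') = square_sum l + square_sum l'"
  by (simp add: square_sum_def)

text \<open>
  The witness combines the number of parts, which decreases under merging and is neutral in the
  second family of constraints, the sum of the squared parts, which is strict there unless the pairs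
  are diagonal, and the sum of the squared multiplicities, which then separates \<open>nu\<close> from
  \<open>rho\<close>. The coefficients let each term dominate the later ones.
\<close>

lemma ex_strict_interior_direction:
  obtains u :: "nat multiset \<Rightarrow> real" where "merge_monotone (2 * d) u"
    "\<And>P nu rho. admissible d P nu rho \<Longrightarrow> (\<exists>(a, b)\<in>#P. a \<noteq> b) \<or> nu \<noteq> rho \<Longrightarrow>
      2 * u (image_mset (\<lambda>(a, b). a + b) P + nu + rho) <
        u (image_mset (\<lambda>(a, b). 2 * a) P + nu + nu) + u (image_mset (\<lambda>(a, b). 2 * b) P + rho + rho)"
proof -
  define k where "k = 2 * d"
  \<comment> \<open>\<open>C\<close> bounds the multiplicity term. A pair of distinct entries gains
    at least \<open>2 * B\<close>, which exceeds \<open>2 * C\<close>. Merging removes one part,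
    worth \<open>A\<close>, while the squared parts grow by at most 2 k^2 and the multiplicity term
    by at most \<open>C\<close>.\<close>
  define C where "C = (real k + 1) * (real k)\<^sup>2"
  define B where "B = C + 1"
  define A where "A = 2 * B * (real k)\<^sup>2 + C"
  define u where "u l = A * real (size l) + B * square_sum l + count_square_sum k l" for l
  have C0: "0 \<le> C" by (simp add: C_def)
  have B0: "0 < B" using C0 by (simp add: B_def)
  have cnt: "count_square_sum k l \<le> C" if "l \<in> even_partitions k" for l
    unfolding C_def by (rule count_square_sum_le[OF that])
  have "merge_monotone k u"
    unfolding merge_monotone_def
  proof (intro allI impI)
    fix a b mu assume e: "add_mset a (add_mset b mu) \<in> even_partitions k"
    then have "real a * real b \<le> real k * real k"
      by (intro mult_mono) (auto simp: even_partitions_def)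
    then have "2 * B * (real a * real b) \<le> 2 * B * (real k)\<^sup>2"
      using B0 by (simp add: power2_eq_square)
    moreover have "count_square_sum k (add_mset (a + b) mu) \<le> C"
      by (rule cnt[OF even_partitions_merge[OF e]])
    moreover have "0 \<le> count_square_sum k (add_mset a (add_mset b mu))" by (rule count_square_sum_nonneg)
    ultimately show "u (add_mset (a + b) mu) \<le> u (add_mset a (add_mset b mu))"
      by (simp add: u_def A_def square_sum_def power2_sum algebra_simps)
  qed
  moreover have "2 * u (image_mset (\<lambda>(a, b). a + b) P + nu + rho) <
      u (image_mset (\<lambda>(a, b). 2 * a) P + nu + nu) + u (image_mset (\<lambda>(a, b). 2 * b) P + rho + rho)"
    if adm: "admissible d P nu rho" and strict: "(\<exists>(a, b)\<in>#P. a \<noteq> b) \<or> nu \<noteq> rho" for P nu rho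
  proof -
    let ?l1 = "image_mset (\<lambda>(a, b). 2 * a) P + nu + nu"
    let ?l2 = "image_mset (\<lambda>(a, b). a + b) P + nu + rho"
    let ?l3 = "image_mset (\<lambda>(a, b). 2 * b) P + rho + rho"
    let ?s = "\<Sum>(a, b)\<in>#P. 2 * (real a - real b)\<^sup>2"
    have sq: "square_sum ?l1 + square_sum ?l3 - 2 * square_sum ?l2 = ?s"
      using square_sum_pairs[of P] by (simp add: square_sum_plus)
    have diff: "u ?l1 + u ?l3 - 2 * u ?l2 =
        B * ?s + (count_square_sum k ?l1 + count_square_sum k ?l3 - 2 * count_square_sum k ?l2)"
    proof -
      have "A * s1 + B * q1 + c1 + (A * s3 + B * q3 + c3) - 2 * (A * s2 + B * q2 + c2) =
          B * (q1 + q3 - 2 * q2) + (c1 + c3 - 2 * c2)" if "s1 = 2 * s2 - s3"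
        for s1 s2 s3 q1 q2 q3 c1 c2 c3 :: real
        unfolding that by (simp add: algebra_simps)
      note combine = this
      show ?thesis unfolding sq[symmetric] u_def by (rule combine) simp
    qed
    show ?thesis
    proof (cases "\<exists>(a, b)\<in>#P. a \<noteq> b")
      case True
      then obtain a b P' where P: "P = add_mset (a, b) P'" and ab: "a \<noteq> b"
        by (auto dest: multi_member_split)
      have "1 \<le> \<bar>real a - real b\<bar>" using ab by linarith
      then have "1 \<le> (real a - real b)\<^sup>2" by (simp add: abs_le_square_iff[of 1, simplified])
      moreover have "0 \<le> (\<Sum>(a, b)\<in>#P'. 2 * (real a - real b)\<^sup>2)"
        by (induction P') auto
      ultimately have "2 \<le> ?s" by (simp add: P)
      then have "B * 2 \<le> B * ?s" using B0 by (simp add: mult_le_cancel_left)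
      moreover have "count_square_sum k ?l2 \<le> C"
        using admissible_even_partitions(2)[OF adm] by (intro cnt) (simp add: k_def)
      ultimately have "0 < u ?l1 + u ?l3 - 2 * u ?l2"
        unfolding diff using count_square_sum_nonneg[of k ?l1] count_square_sum_nonneg[of k ?l3]
        by (simp add: B_def)
      then show ?thesis by simp
    next
      case False
      let ?D = "image_mset (\<lambda>(a, b). 2 * a) P"
      have same: "image_mset (\<lambda>(a, b). a + b) P = ?D" "image_mset (\<lambda>(a, b). 2 * b) P = ?D"
        using False by (auto intro!: image_mset_cong)
      have "?s = (\<Sum>_\<in>#P. 0)"
        by (rule arg_cong[of _ _ sum_mset], rule image_mset_cong) (use False in auto)
      then have s0: "?s = 0" by simp
      have "nu \<noteq> rho" using strict False by blast
      then obtain r where r: "count nu r \<noteq> count rho r" by (auto simp: multiset_eq_iff)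
      then have "r \<in># nu \<or> r \<in># rho" by (metis not_in_iff)
      then have rk: "r \<le> k"
      proof
        assume "r \<in># nu"
        then obtain M where "nu = add_mset r M" by (auto dest: multi_member_split)
        then show ?thesis using adm by (simp add: admissible_def k_def)
      next
        assume "r \<in># rho"
        then obtain M where "rho = add_mset r M" by (auto dest: multi_member_split)
        then show ?thesis using adm by (simp add: admissible_def k_def)
      qed
      have "count_square_sum k ?l1 + count_square_sum k ?l3 - 2 * count_square_sum k ?l2 =
          (\<Sum>r\<le>k. 2 * (real (count nu r) - real (count rho r))\<^sup>2)"
        unfolding same count_square_sum_def sum_distrib_left sum.distrib[symmetric] sum_subtractf[symmetric]
        by (intro sum.cong refl) (simp add: power2_eq_square algebra_simps)
      also have "\<dots> > 0"
        using r rk by (intro sum_pos2[of _ r]) auto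
      finally have "0 < u ?l1 + u ?l3 - 2 * u ?l2" unfolding diff s0 by simp
      then show ?thesis by simp
    qed
  qed
  ultimately show thesis using that[of u] by (simp add: k_def)
qed

text \<open>With \<open>1 / \<tau> = n powr (1 / N)\<close>, logarithms in this base are
  \<open>N\<close> times those in base \<open>n\<close>. The constants in the moment bounds have
  logarithms bounded by \<open>D\<close>, so the error is at most
  \<open>N * D / ln n\<close>.\<close>

lemma (in gapped_exponent) approximating_dual_point:
  assumes N: "0 < N" and e: "0 < e"
  obtains x \<tau> where "x \<in> dual_cone (even_partitions (2 * d)) (BSigma (2 * d))"
    "\<And>l. l \<in> even_partitions (2 * d) \<Longrightarrow> 0 < x l" "0 < \<tau>" "\<tau> < e" "\<tau> < 1"
    "\<And>l. l \<in> even_partitions (2 * d) \<Longrightarrow> \<bar>log (1 / \<tau>) (x l) - N * z l\<bar> \<le> e"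
proof -
  let ?I = "even_partitions (2 * d)"
  define D where "D = real (2 * d) * ln 2 + real (2 * d) * ln (real (2 * d) + 1)"
  obtain n0 where n0: "\<And>n. n0 \<le> n \<Longrightarrow> restrict (\<lambda>l. moment n z (power_sum_product n l)) ?I \<in> dual_cone ?I (BSigma (2 * d))"
    using eventually_moments_in_dual_cone by blast
  have ln_top: "filterlim (\<lambda>n. ln (real n)) at_top sequentially"
    by (rule filterlim_compose[OF ln_at_top filterlim_real_sequentially])
  have "\<forall>\<^sub>F n in sequentially. max 1 (N * D / e) \<le> ln (real n)"
    using ln_top unfolding filterlim_at_top by blast
  moreover have "((\<lambda>n. real n powr (- (1 / N))) \<longlongrightarrow> 0) sequentially"
    using N by (intro tendsto_neg_powr filterlim_real_sequentially) auto
  then have "\<forall>\<^sub>F n in sequentially. real n powr (- (1 / N)) < min e 1"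
    by (rule order_tendstoD) (use e in auto)
  moreover have "\<forall>\<^sub>F n in sequentially. max n0 (4 * d) \<le> n"
    by (rule eventually_ge_at_top)
  ultimately have "\<forall>\<^sub>F n in sequentially. max 1 (N * D / e) \<le> ln (real n) \<and>
      real n powr (- (1 / N)) < min e 1 \<and> max n0 (4 * d) \<le> n"
    by eventually_elim auto
  then obtain n where n: "1 \<le> ln (real n)" "N * D / e \<le> ln (real n)"
      "real n powr (- (1 / N)) < min e 1" "n0 \<le> n" "4 * d \<le> n"
    by (auto dest!: eventually_happens)
  have npos: "0 < n" using n(5) d by linarith
  define x where "x = restrict (\<lambda>l. moment n z (power_sum_product n l)) ?I"
  define \<tau> where "\<tau> = real n powr (- (1 / N))"
  have bounds: "(1 / 2) ^ (2 * d) * n powr z l \<le> x l" "x l \<le> (real (2 * d) + 1) ^ (2 * d) * n powr z l"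
    if "l \<in> ?I" for l
    using moment_power_sum_product_bounds[OF merge npos _ that] n(5) that by (simp_all add: x_def)
  have pos: "0 < x l" if l: "l \<in> ?I" for l
  proof -
    have "0 < (1 / 2) ^ (2 * d) * n powr z l" using npos by simp
    with bounds(1)[OF l] show ?thesis by linarith
  qed
  have "1 / \<tau> = real n powr (1 / N)" by (simp add: \<tau>_def powr_minus field_simps)
  then have lnt: "ln (1 / \<tau>) = ln n / N" using npos by (simp add: ln_powr)
  have "\<bar>log (1 / \<tau>) (x l) - N * z l\<bar> \<le> e" if l: "l \<in> ?I" for l
  proof -
    have "ln ((1 / 2) ^ (2 * d) * n powr z l) \<le> ln (x l)"
      using bounds(1)[OF l] pos[OF l] npos by (subst ln_le_cancel_iff) auto
    then have lo: "- (real (2 * d) * ln 2) + z l * ln n \<le> ln (x l)"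
      using npos by (simp add: ln_mult ln_powr ln_realpow ln_div)
    have "ln (x l) \<le> ln ((real (2 * d) + 1) ^ (2 * d) * n powr z l)"
      using bounds(2)[OF l] pos[OF l] npos by (subst ln_le_cancel_iff) (auto intro: mult_pos_pos)
    then have hi: "ln (x l) \<le> real (2 * d) * ln (real (2 * d) + 1) + z l * ln n"
      using npos by (simp add: ln_mult ln_powr ln_realpow)
    have nonneg: "0 \<le> real (2 * d) * ln 2" "0 \<le> real (2 * d) * ln (real (2 * d) + 1)"
      by (auto intro!: mult_nonneg_nonneg ln_ge_zero)
    have "\<bar>ln (x l) - z l * ln n\<bar> \<le> D"
      unfolding D_def using lo hi nonneg by linarith
    then have "N / ln n * \<bar>ln (x l) - z l * ln n\<bar> \<le> N / ln n * D"
      using N n(1) by (intro mult_left_mono) auto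
    also have "\<dots> \<le> e" using n(1,2) e by (simp add: field_simps)
    also have "N / ln n * \<bar>ln (x l) - z l * ln n\<bar> = \<bar>N / ln n * (ln (x l) - z l * ln n)\<bar>"
      using N n(1) by (simp add: abs_mult)
    also have "N / ln n * (ln (x l) - z l * ln n) = log (1 / \<tau>) (x l) - N * z l"
      using N n(1) unfolding log_def lnt by (simp add: field_simps)
    finally show ?thesis .
  qed
  moreover have "0 < \<tau>" "\<tau> < e" "\<tau> < 1" using n(3) npos by (auto simp: \<tau>_def)
  moreover have "x \<in> dual_cone ?I (BSigma (2 * d))" unfolding x_def by (rule n0[OF n(4)])
  ultimately show thesis using pos that by blast
qed

text \<open>The direction \<open>u\<close> makes every nondegenerate inequality of the second family
  strict. Only finitely many triples of partitions exist, so the slack is bounded away from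
  zero.\<close>

lemma ex_gapped_exponent:
  assumes d: "1 \<le> d" and y: "\<And>l1 l2 l3. (l1, l2, l3) \<in> constraints d \<Longrightarrow> 2 * y l2 \<le> y l1 + y l3"
    and u: "merge_monotone (2 * d) u"
      "\<And>P nu rho. admissible d P nu rho \<Longrightarrow> (\<exists>(a, b)\<in>#P. a \<noteq> b) \<or> nu \<noteq> rho \<Longrightarrow>
        2 * u (image_mset (\<lambda>(a, b). a + b) P + nu + rho) <
          u (image_mset (\<lambda>(a, b). 2 * a) P + nu + nu) + u (image_mset (\<lambda>(a, b). 2 * b) P + rho + rho)"
    and e: "0 < e"
  obtains N \<delta> :: real where "0 < N" "gapped_exponent d (\<lambda>l. (y l + e * u l) / N) \<delta>"
proof -
  let ?I = "even_partitions (2 * d)"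
  have fin: "finite ?I" by (rule finite_even_partitions)
  \<comment> \<open>The factor 8 yields the bound 1/8 on \<open>z\<close>; the summand 1 keeps
    \<open>N\<close> positive.\<close>
  define N where "N = 8 * (1 + (\<Sum>l\<in>?I. \<bar>y l + e * u l\<bar>))"
  have N: "0 < N" by (simp add: N_def add_pos_nonneg sum_nonneg)
  define z where "z l = (y l + e * u l) / N" for l
  define V where "V = (\<lambda>(l1, l2, l3). z l1 + z l3 - 2 * z l2) ` (?I \<times> ?I \<times> ?I) \<inter> {0<..}"
  \<comment> \<open>Inserting 1/2 keeps the set nonempty and yields \<delta> \<le> 1/4; the outer
    halving is there because the gap is stated as \<open>2 * \<delta>\<close>.\<close>
  define \<delta> where "\<delta> = Min (insert (1 / 2) V) / 2"
  have finV: "finite V" using fin by (simp add: V_def)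
  have "Min (insert (1 / 2) V) \<le> 1 / 2" using finV by (intro Min_le) auto
  moreover have "0 < v" if "v \<in> V" for v using that by (simp add: V_def)
  ultimately have \<delta>0: "0 < \<delta>" "\<delta> \<le> 1 / 4" using finV by (auto simp: \<delta>_def)
  have \<delta>V: "2 * \<delta> \<le> v" if "v \<in> V" for v using finV that by (simp add: \<delta>_def)
  have "gapped_exponent d z \<delta>"
  proof
    show "1 \<le> d" by fact
    show "0 < \<delta>" "\<delta> \<le> 1 / 4" by fact+
    show "merge_monotone (2 * d) z" unfolding merge_monotone_def
    proof (intro allI impI)
      fix a b mu assume l: "add_mset a (add_mset b mu) \<in> ?I"
      have "2 * y (add_mset (a + b) mu) \<le> y (add_mset a (add_mset b mu)) + y (add_mset a (add_mset b mu))"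
        by (rule y) (use l in \<open>auto simp: constraints_def\<close>)
      moreover have "e * u (add_mset (a + b) mu) \<le> e * u (add_mset a (add_mset b mu))"
        using e by (intro mult_left_mono merge_monotoneD[OF u(1) l]) auto
      ultimately show "z (add_mset (a + b) mu) \<le> z (add_mset a (add_mset b mu))"
        unfolding z_def using N by (intro divide_right_mono) auto
    qed
    show "\<bar>z l\<bar> \<le> 1 / 8" if l: "l \<in> ?I" for l
    proof -
      have "\<bar>y l + e * u l\<bar> \<le> (\<Sum>l\<in>?I. \<bar>y l + e * u l\<bar>)"
        using fin l by (intro member_le_sum) auto
      then have "8 * \<bar>y l + e * u l\<bar> \<le> N" by (simp add: N_def)
      then show ?thesis using N by (simp add: z_def field_simps)
    qed
    fix P nu rho assume adm: "admissible d P nu rho" and strict: "(\<exists>(a, b)\<in>#P. a \<noteq> b) \<or> nu \<noteq> rho"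
    let ?l1 = "image_mset (\<lambda>(a, b). 2 * a) P + nu + nu"
    let ?l2 = "image_mset (\<lambda>(a, b). a + b) P + nu + rho"
    let ?l3 = "image_mset (\<lambda>(a, b). 2 * b) P + rho + rho"
    have "2 * y ?l2 \<le> y ?l1 + y ?l3"
      by (rule y) (use adm in \<open>auto simp: constraints_def\<close>)
    moreover have "e * (2 * u ?l2) < e * (u ?l1 + u ?l3)"
      using e by (intro mult_strict_left_mono u(2) adm strict)
    ultimately have "0 < (y ?l1 + e * u ?l1) + (y ?l3 + e * u ?l3) - 2 * (y ?l2 + e * u ?l2)"
      by (simp add: algebra_simps)
    then have "0 < ((y ?l1 + e * u ?l1) + (y ?l3 + e * u ?l3) - 2 * (y ?l2 + e * u ?l2)) / N"
      using N by simp
    then have "0 < z ?l1 + z ?l3 - 2 * z ?l2"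
      by (simp add: z_def add_divide_distrib diff_divide_distrib)
    moreover have "(?l1, ?l2, ?l3) \<in> ?I \<times> ?I \<times> ?I"
      using admissible_even_partitions[OF adm] by simp
    ultimately have "z ?l1 + z ?l3 - 2 * z ?l2 \<in> V"
      unfolding V_def by (intro IntI image_eqI[of _ _ "(?l1, ?l2, ?l3)"]) auto
    from \<delta>V[OF this] show "2 * z ?l2 + 2 * \<delta> \<le> z ?l1 + z ?l3" by simp
  qed
  with N show thesis unfolding z_def by (rule that)
qed

text \<open>Since \<open>y\<close> may satisfy constraints with equality, it is approached through
  \<open>y + e * u\<close> with \<open>e = 1 / Suc m\<close>. The error
  \<open>e * (1 + \<bar>u l\<bar>)\<close> adds the approximation at fixed \<open>e\<close> to the
  perturbation itself.\<close>

lemma in_trop_dual_cone: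
  assumes d: "1 \<le> d" and ext: "y \<in> even_partitions (2 * d) \<rightarrow>\<^sub>E UNIV"
    and y: "\<And>l1 l2 l3. (l1, l2, l3) \<in> constraints d \<Longrightarrow> 2 * y l2 \<le> y l1 + y l3"
  shows "y \<in> trop (even_partitions (2 * d)) (dual_cone (even_partitions (2 * d)) (BSigma (2 * d)))"
proof -
  let ?I = "even_partitions (2 * d)" and ?S = "dual_cone (even_partitions (2 * d)) (BSigma (2 * d))"
  obtain u where u: "merge_monotone (2 * d) u"
      "\<And>P nu rho. admissible d P nu rho \<Longrightarrow> (\<exists>(a, b)\<in>#P. a \<noteq> b) \<or> nu \<noteq> rho \<Longrightarrow>
        2 * u (image_mset (\<lambda>(a, b). a + b) P + nu + rho) <
          u (image_mset (\<lambda>(a, b). 2 * a) P + nu + nu) + u (image_mset (\<lambda>(a, b). 2 * b) P + rho + rho)"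
  proof (rule ex_strict_interior_direction[of d], goal_cases)
    case (1 u)
    from 1(2-) show thesis by (rule that)
  qed
  define approx where "approx e p \<longleftrightarrow> fst p \<in> ?S \<and> (\<forall>l\<in>?I. 0 < fst p l) \<and> 0 < snd p \<and> snd p < e \<and> snd p < 1 \<and>
      (\<forall>l\<in>?I. \<bar>log (1 / snd p) (fst p l) - y l\<bar> \<le> e * (1 + \<bar>u l\<bar>))" for e p
  have ex: "\<exists>p. approx e p" if e: "0 < e" for e :: real
  proof -
    obtain N \<delta> :: real where N: "0 < N" and "gapped_exponent d (\<lambda>l. (y l + e * u l) / N) \<delta>"
      by (rule ex_gapped_exponent[OF d y u e])
    then interpret gapped_exponent d "\<lambda>l. (y l + e * u l) / N" \<delta> by simp
    obtain x \<tau> where x: "x \<in> ?S" "\<And>l. l \<in> ?I \<Longrightarrow> 0 < x l" "0 < \<tau>" "\<tau> < e" "\<tau> < 1"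
      and lim: "\<And>l. l \<in> ?I \<Longrightarrow> \<bar>log (1 / \<tau>) (x l) - N * ((y l + e * u l) / N)\<bar> \<le> e"
    proof (rule approximating_dual_point[OF N e], goal_cases)
      case (1 x \<tau>)
      from 1(2-) show thesis by (rule that)
    qed
    have "\<bar>log (1 / \<tau>) (x l) - y l\<bar> \<le> e * (1 + \<bar>u l\<bar>)" if "l \<in> ?I" for l
    proof -
      have "\<bar>log (1 / \<tau>) (x l) - (y l + e * u l)\<bar> \<le> e" using lim[OF that] N by simp
      moreover have "\<bar>e * u l\<bar> = e * \<bar>u l\<bar>" using e by (simp add: abs_mult)
      ultimately show ?thesis unfolding distrib_left by linarith
    qed
    then show ?thesis using x by (intro exI[of _ "(x, \<tau>)"]) (simp add: approx_def)
  qed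
  have "\<exists>p. \<forall>m. approx (1 / real (Suc m)) (p m)"
    by (intro choice allI ex) simp
  then obtain p where "\<And>m. approx (1 / real (Suc m)) (p m)" by blast
  then have p: "\<And>m. fst (p m) \<in> ?S" "\<And>m l. l \<in> ?I \<Longrightarrow> 0 < fst (p m) l" "\<And>m. 0 < snd (p m)"
      "\<And>m. snd (p m) < 1 / real (Suc m)" "\<And>m. snd (p m) < 1"
      "\<And>m l. l \<in> ?I \<Longrightarrow> \<bar>log (1 / snd (p m)) (fst (p m) l) - y l\<bar> \<le> 1 / real (Suc m) * (1 + \<bar>u l\<bar>)"
    unfolding approx_def by blast+
  have inv: "(\<lambda>m. 1 / real (Suc m)) \<longlonglongrightarrow> 0"
    using LIMSEQ_inverse_real_of_nat by (simp add: inverse_eq_divide)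
  have "(\<lambda>m. snd (p m)) \<longlonglongrightarrow> 0"
    by (rule tendsto_sandwich[OF _ _ tendsto_const inv])
       (use p(3,4) in \<open>auto intro!: always_eventually less_imp_le\<close>)
  moreover have "(\<lambda>m. log (1 / snd (p m)) (fst (p m) l)) \<longlonglongrightarrow> y l" if l: "l \<in> ?I" for l
  proof -
    have "(\<lambda>m. log (1 / snd (p m)) (fst (p m) l) - y l) \<longlonglongrightarrow> 0"
    proof (rule Lim_null_comparison)
      show "\<forall>\<^sub>F m in sequentially. norm (log (1 / snd (p m)) (fst (p m) l) - y l) \<le> 1 / real (Suc m) * (1 + \<bar>u l\<bar>)"
        unfolding real_norm_def by (intro always_eventually allI p(6) l)
      show "(\<lambda>m. 1 / real (Suc m) * (1 + \<bar>u l\<bar>)) \<longlonglongrightarrow> 0"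
        by (rule tendsto_mult_left_zero[OF inv])
    qed
    then show ?thesis by (rule LIM_zero_cancel)
  qed
  ultimately show ?thesis
    unfolding trop_def using ext p(1,2,3,5)
    by (intro CollectI conjI exI[of _ "\<lambda>m. fst (p m)"] exI[of _ "\<lambda>m. snd (p m)"]) auto
qed

theorem proposition5p19:
  fixes d :: nat
  assumes "1 \<le> d"
  shows "rational_polyhedron (even_partitions (2 * d))
           (trop (even_partitions (2 * d)) (dual_cone (even_partitions (2 * d)) (BSigma (2 * d))))"
proof -
  let ?I = "even_partitions (2 * d)"
  \<comment> \<open>The contributions are subtracted one by one, so the formula stays correct for
    triples with repeated entries, such as those from merging.\<close>
  define coeff :: "nat multiset \<times> nat multiset \<times> nat multiset \<Rightarrow> nat multiset \<Rightarrow> rat" where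
    "coeff = (\<lambda>(l1, l2, l3) i. (if i = l2 then 2 else 0) - (if i = l1 then 1 else 0) - (if i = l3 then 1 else 0))"
  let ?H = "(\<lambda>t. (coeff t, 0 :: rat)) ` constraints d"
  have eval_coeff: "(\<Sum>i\<in>?I. of_rat (coeff (l1, l2, l3) i) * y i) = 2 * y l2 - y l1 - y l3"
    if "(l1, l2, l3) \<in> constraints d" for l1 l2 l3 and y :: "nat multiset \<Rightarrow> real"
  proof -
    have l: "l1 \<in> ?I" "l2 \<in> ?I" "l3 \<in> ?I" using that constraints_subset by auto
    have "(\<Sum>i\<in>?I. of_rat (coeff (l1, l2, l3) i) * y i) =
        (\<Sum>i\<in>?I. (if i = l2 then 2 * y i else 0) - (if i = l1 then y i else 0) - (if i = l3 then y i else 0))"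
      by (intro sum.cong refl) (auto simp: coeff_def of_rat_diff)
    then show ?thesis using l by (simp add: sum_subtractf finite_even_partitions)
  qed
  have "finite ?H"
    by (intro finite_imageI finite_subset[OF constraints_subset] finite_cartesian_product finite_even_partitions)
  moreover have "trop ?I (dual_cone ?I (BSigma (2 * d))) =
      {y \<in> ?I \<rightarrow>\<^sub>E UNIV. \<forall>(a, b)\<in>?H. (\<Sum>i\<in>?I. of_rat (a i) * y i) \<le> of_rat b}"
  proof (intro equalityI subsetI CollectI conjI)
    fix y :: "nat multiset \<Rightarrow> real"
    assume y: "y \<in> trop ?I (dual_cone ?I (BSigma (2 * d)))"
    then show "y \<in> ?I \<rightarrow>\<^sub>E UNIV" by (simp add: trop_def)
    show "\<forall>(a, b)\<in>?H. (\<Sum>i\<in>?I. of_rat (a i) * y i) \<le> of_rat b"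
      using trop_dual_cone_constraint[OF y] by (fastforce simp: eval_coeff)
  next
    fix y :: "nat multiset \<Rightarrow> real"
    assume y: "y \<in> {y \<in> ?I \<rightarrow>\<^sub>E UNIV. \<forall>(a, b)\<in>?H. (\<Sum>i\<in>?I. of_rat (a i) * y i) \<le> of_rat b}"
    show "y \<in> trop ?I (dual_cone ?I (BSigma (2 * d)))"
    proof (rule in_trop_dual_cone[OF assms])
      show "y \<in> ?I \<rightarrow>\<^sub>E UNIV" using y by blast
      fix l1 l2 l3 assume c: "(l1, l2, l3) \<in> constraints d"
      then have "(\<Sum>i\<in>?I. of_rat (coeff (l1, l2, l3) i) * y i) \<le> 0" using y by force
      then show "2 * y l2 \<le> y l1 + y l3" by (simp add: eval_coeff[OF c])
    qed
  qed
  ultimately show ?thesis unfolding rational_polyhedron_def by blast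
qed

end
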